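(* Let $q$ be an odd prime power and $n\ge 1$. Let $\mathcal{K}=\{K_1,\ldots,K_s\}$ be a dual pseudo-arc in $\mathrm{PG}(3n-1,q)$ with $s>m_2'(q^n)$ elements, and for each $i$ let $\mathcal{S}_i=\{K_j\cap K_i: j\ne i\}$. If $\mathcal{S}_i$ extends to a Desarguesian spread of $K_i\cong\mathrm{PG}(2n-1,q)$ for some $1\le i\le s$, then $\mathcal{K}$ can be extended to a dual pseudo-conic.
   Context: A dual pseudo-arc in $\mathrm{PG}(3n-1,q)$ is a set of $(2n-1)$-dimensional subspaces any three of which have empty intersection. $m_2'(r)$ denotes the size of the second largest complete arc in $\mathrm{PG}(2,r)$; here an arc is a set of points no three collinear, and it is complete if it is not contained in a larger arc. Field reduction identifies $\mathbb{F}_{q^n}^3$ with $\mathbb{F}_q^{3n}$, so that each point of $\mathrm{PG}(2,q^n)$ corresponds to an $(n-1)$-space of $\mathrm{PG}(3n-1,q)$. Similarly, each point of $\mathrm{PG}(1,q^n)$ corresponds to an $(n-1)$-space of $\mathrm{PG}(2n-1,q)$; the resulting spread is a Desarguesian spread. A pseudo-conic is the set of $q^n+1$ $(n-1)$-spaces obtained by field reduction from the points of a conic of $\mathrm{PG}(2,q^n)$. A dual pseudo-conic is the image of a pseudo-conic under a duality of $\mathrm{PG}(3n-1,q)$, i.e. a set of $q^n+1$ $(2n-1)$-spaces. *)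

theory Defs
  imports "HOL-Analysis.Determinants"
begin

text \<open>
  A projective space over a field is represented by the lattice of linear subspaces of a
  coordinate space; a projective subspace of dimension \<open>d\<close> is a linear subspace of dimension
  \<open>d + 1\<close>, and the empty projective subspace is the linear subspace \<open>{0}\<close>.
\<close>

definition proj_points :: "('k::field ^ 'd) set set" where
  "proj_points = {P. vec.subspace P \<and> vec.dim P = 1}"

definition collinear3 :: "('k::field ^ 'd) set \<Rightarrow> ('k ^ 'd) set \<Rightarrow> ('k ^ 'd) set \<Rightarrow> bool" where
  "collinear3 P Q R \<longleftrightarrow>
     (\<exists>l. vec.subspace l \<and> vec.dim l = 2 \<and> P \<subseteq> l \<and> Q \<subseteq> l \<and> R \<subseteq> l)"

definition planar_arc :: "('k::field ^ 3) set set \<Rightarrow> bool" where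
  "planar_arc A \<longleftrightarrow> A \<subseteq> proj_points \<and>
     (\<forall>P\<in>A. \<forall>Q\<in>A. \<forall>R\<in>A. P \<noteq> Q \<and> P \<noteq> R \<and> Q \<noteq> R \<longrightarrow> \<not> collinear3 P Q R)"

definition complete_arc :: "('k::field ^ 3) set set \<Rightarrow> bool" where
  "complete_arc A \<longleftrightarrow> planar_arc A \<and> (\<forall>B. planar_arc B \<and> A \<subseteq> B \<longrightarrow> B = A)"

definition complete_arc_sizes :: "'k::{field,finite} itself \<Rightarrow> nat set" where
  "complete_arc_sizes _ = {card A | A :: ('k ^ 3) set set. complete_arc A}"

text \<open>
  The number \<open>m\<^sub>2'(r)\<close>, where \<open>r\<close> is the order of the field \<open>'k\<close>: the second largest size of a
  complete arc. For very small \<open>r\<close> (such as 3 and 5) all complete arcs have the same size, so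
  that there is no second largest one; the value is then 0 by convention.
\<close>

definition m2' :: "'k::{field,finite} itself \<Rightarrow> nat" where
  "m2' t = (let S = {k \<in> complete_arc_sizes t. k < Max (complete_arc_sizes t)}
            in if S = {} then 0 else Max S)"

text \<open>
  Every quadratic form over a field of odd order is \<open>x \<mapsto> x\<^sup>T A x\<close> for a unique symmetric matrix
  \<open>A\<close>, and it is nondegenerate iff \<open>det A \<noteq> 0\<close>. In characteristic 2 this would not be the right
  notion of a conic.
\<close>

definition conic :: "('k::field ^ 3) set set \<Rightarrow> bool" where
  "conic C \<longleftrightarrow> (\<exists>A :: 'k ^ 3 ^ 3. transpose A = A \<and> det A \<noteq> 0 \<and>
     C = {P \<in> proj_points. \<forall>x\<in>P. (\<Sum>i\<in>UNIV. \<Sum>j\<in>UNIV. A $ i $ j * x $ i * x $ j) = 0})"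

definition field_embedding :: "('q::field \<Rightarrow> 'k::field) \<Rightarrow> bool" where
  "field_embedding \<iota> \<longleftrightarrow> \<iota> 1 = 1 \<and>
     (\<forall>a b. \<iota> (a + b) = \<iota> a + \<iota> b) \<and> (\<forall>a b. \<iota> (a * b) = \<iota> a * \<iota> b)"

text \<open>
  An identification of \<open>'k ^ 'd\<close>, regarded as a vector space over \<open>'q\<close> by restricting scalars
  along \<open>\<iota>\<close>, with a subspace \<open>W\<close> of \<open>'q ^ 'm\<close>. The image of a point under it is the subspace
  corresponding to this point under field reduction.
\<close>

definition field_reduction ::
  "('q::field \<Rightarrow> 'k::field) \<Rightarrow> ('k ^ 'd \<Rightarrow> 'q ^ 'm) \<Rightarrow> ('q ^ 'm) set \<Rightarrow> bool" where
  "field_reduction \<iota> \<phi> W \<longleftrightarrow>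
     Vector_Spaces.linear (\<lambda>c x. \<iota> c *s x) (*s) \<phi> \<and> inj \<phi> \<and> range \<phi> = W"

definition desarguesian_spread ::
  "('q::field \<Rightarrow> 'k::field) \<Rightarrow> ('q ^ 'm) set \<Rightarrow> ('q ^ 'm) set set \<Rightarrow> bool" where
  "desarguesian_spread \<iota> W D \<longleftrightarrow>
     (\<exists>\<psi> :: 'k ^ 2 \<Rightarrow> 'q ^ 'm. field_reduction \<iota> \<psi> W \<and> D = (\<lambda>P. \<psi> ` P) ` proj_points)"

definition pseudo_conic ::
  "('q::field \<Rightarrow> 'k::field) \<Rightarrow> ('q ^ 'm) set set \<Rightarrow> bool" where
  "pseudo_conic \<iota> \<O> \<longleftrightarrow>
     (\<exists>(\<phi> :: 'k ^ 3 \<Rightarrow> 'q ^ 'm) C. field_reduction \<iota> \<phi> UNIV \<and> conic C \<and> \<O> = (\<lambda>P. \<phi> ` P) ` C)"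

definition duality :: "(('q::field ^ 'm) set \<Rightarrow> ('q ^ 'm) set) \<Rightarrow> bool" where
  "duality \<delta> \<longleftrightarrow> bij_betw \<delta> {U. vec.subspace U} {U. vec.subspace U} \<and>
     (\<forall>U W. vec.subspace U \<longrightarrow> vec.subspace W \<longrightarrow> (U \<subseteq> W \<longleftrightarrow> \<delta> W \<subseteq> \<delta> U))"

definition dual_pseudo_conic ::
  "('q::field \<Rightarrow> 'k::field) \<Rightarrow> ('q ^ 'm) set set \<Rightarrow> bool" where
  "dual_pseudo_conic \<iota> \<D> \<longleftrightarrow> (\<exists>\<delta> \<O>. duality \<delta> \<and> pseudo_conic \<iota> \<O> \<and> \<D> = \<delta> ` \<O>)"

definition dual_pseudo_arc :: "nat \<Rightarrow> ('q::field ^ 'm) set set \<Rightarrow> bool" where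
  "dual_pseudo_arc n \<K> \<longleftrightarrow>
     (\<forall>K\<in>\<K>. vec.subspace K \<and> vec.dim K = 2 * n) \<and>
     (\<forall>K\<in>\<K>. \<forall>L\<in>\<K>. \<forall>M\<in>\<K>. K \<noteq> L \<and> K \<noteq> M \<and> L \<noteq> M \<longrightarrow> K \<inter> L \<inter> M = {0})"

end

theory Submission
  imports Defs "HOL-Computational_Algebra.Polynomial"
begin

text \<open>
  Choose coordinates \<open>(x, y, w)\<close> over the big field such that the distinguished element \<open>K\<close> is
  \<open>w = 0\<close> and the Desarguesian spread of \<open>K\<close> consists of the lines through the origin of the
  \<open>(x, y)\<close>-plane. Every other element is then \<open>a\<^sub>i x + b\<^sub>i y = g\<^sub>i(w)\<close>, where \<open>g\<^sub>i\<close> is linear over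
  the small field only. For each fixed \<open>w \<noteq> 0\<close> the points \<open>(0, 0, 1)\<close> and \<open>(a\<^sub>i, b\<^sub>i, -g\<^sub>i(w))\<close>
  form an arc of more than \<open>m\<^sub>2'\<close> points, which by Segre's theorem lies on a conic; hence
  \<open>g\<^sub>i(w) = Q\<^sub>w(a\<^sub>i, b\<^sub>i) / L\<^sub>w(a\<^sub>i, b\<^sub>i)\<close> with a quadratic form \<open>Q\<^sub>w\<close> and a linear form \<open>L\<^sub>w\<close>, the
  tangent at \<open>(0, 0, 1)\<close>. Additivity of the \<open>g\<^sub>i\<close> forces all \<open>L\<^sub>w\<close> to be proportional: otherwise
  a quartic form would have too many zeros. Normalising \<open>L\<^sub>w\<close> to be constant turns the equations
  into \<open>X + t\<^sub>i Y + t\<^sub>i\<^sup>2 Z = 0\<close>, where \<open>(X, Y, Z)\<close> are again coordinates over the big field.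
\<close>

section \<open>Finite fields of odd order\<close>

text \<open>Since \<open>f\<close> has no fixed point, the factors cancel in the pairs
  \<open>{x, f x}\<close>. This serves both a parity count (all factors -1) and Wilson's
  theorem.\<close>

lemma prod_involution:
  fixes g :: "'a \<Rightarrow> 'b::comm_monoid_mult"
  assumes "finite S" "\<And>x. x \<in> S \<Longrightarrow> f x \<in> S" "\<And>x. x \<in> S \<Longrightarrow> f (f x) = x"
    "\<And>x. x \<in> S \<Longrightarrow> f x \<noteq> x" "\<And>x. x \<in> S \<Longrightarrow> g x * g (f x) = 1"
  shows "prod g S = 1"
  using assms
proof (induction S rule: finite_psubset_induct)
  case (psubset S)
  show ?case
  proof (cases "S = {}")
    case False
    then obtain x where x: "x \<in> S" by auto
    let ?S = "S - {x, f x}"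
    have "prod g ?S = 1"
    proof (rule psubset.IH)
      show "?S \<subset> S" using x by auto
      fix y assume y: "y \<in> ?S"
      have "f y \<noteq> x" "f y \<noteq> f x"
        using y x psubset.prems(2) by (metis Diff_iff insertCI)+
      then show "f y \<in> ?S" using psubset.prems(1) y by auto
    qed (use psubset.prems in auto)
    moreover have "prod g S = g x * (g (f x) * prod g ?S)"
    proof -
      have "prod g S = g x * prod g (S - {x})"
        using psubset.hyps x by (rule prod.remove)
      also have "prod g (S - {x}) = g (f x) * prod g (S - {x} - {f x})"
        using psubset.hyps x psubset.prems(1,3) by (intro prod.remove) auto
      also have "S - {x} - {f x} = ?S" by auto
      finally show ?thesis .
    qed
    ultimately show ?thesis
      using psubset.prems(4)[OF x] by simp
  qed simp
qed

text \<open>In characteristic 2 the shift by 1 would be an involution without fixed points, so the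
  order of the field would be even. A product of -1 over the field detects this parity.\<close>

lemma two_neq_zero_odd_card:
  assumes "odd CARD('k::{field,finite})"
  shows "(2::'k) \<noteq> 0"
proof
  assume two: "(2::'k) = 0"
  have "(\<Prod>x\<in>(UNIV::'k set). (-1::int)) = 1"
  proof (rule prod_involution[where f = "\<lambda>x. x + 1"])
    fix x :: 'k
    have "x + 1 + 1 = x + 2" by simp
    then show "x + 1 + 1 = x" using two by simp
  qed auto
  then have "(-1::int) ^ CARD('k) = 1" by simp
  then show False using assms by simp
qed

lemma card_odd_field_ge_3:
  assumes "odd CARD('k::{field,finite})"
  shows "3 \<le> CARD('k)"
proof -
  have "card {0, 1::'k} \<le> CARD('k)" by (rule card_mono) auto
  then have "2 \<le> CARD('k)" by simp
  moreover have "CARD('k) \<noteq> 2" using assms by auto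
  ultimately show ?thesis by linarith
qed

text \<open>Wilson's theorem: inversion pairs off all nonzero elements other than 1 and -1.\<close>

lemma prod_nonzero_field:
  assumes "odd CARD('k::{field,finite})"
  shows "(\<Prod>x\<in>UNIV - {0::'k}. x) = -1"
proof -
  note two = two_neq_zero_odd_card[OF assms]
  have ne: "(1::'k) \<noteq> -1" using two by (metis one_add_one add.right_inverse)
  have "(\<Prod>x\<in>UNIV - {0, 1, -1::'k}. x) = 1"
  proof (rule prod_involution[where f = inverse])
    fix x :: 'k assume x: "x \<in> UNIV - {0, 1, -1}"
    show "inverse x \<noteq> x"
    proof
      assume "inverse x = x"
      then have "x * x = 1" using x by (metis DiffD2 insertI1 right_inverse)
      then have "(x - 1) * (x + 1) = 0" by (simp add: algebra_simps)
      then show False using x by (auto simp: eq_neg_iff_add_eq_0)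
    qed
    show "inverse x \<in> UNIV - {0, 1, -1}"
      using x by (auto simp: inverse_eq_iff_eq[of _ "-1::'k", simplified])
  qed auto
  moreover have "UNIV - {0::'k} = insert 1 (insert (-1) (UNIV - {0, 1, -1}))" by auto
  ultimately show ?thesis using ne by simp
qed

lemma prod_inj_nonzero:
  fixes f :: "'a \<Rightarrow> 'k::{field,finite}"
  assumes "odd CARD('k)" "finite S" "inj_on f S" "\<And>x. x \<in> S \<Longrightarrow> f x \<noteq> 0" "card S = CARD('k) - 1"
  shows "prod f S = -1"
proof -
  have "f ` S = UNIV - {0}"
    using assms by (intro card_subset_eq) (auto simp: card_image)
  then have "prod (\<lambda>x. x) (f ` S) = -1"
    using prod_nonzero_field[OF assms(1)] by simp
  then show ?thesis using prod.reindex[OF assms(3), of "\<lambda>x. x"] by (simp add: o_def)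
qed

text \<open>By cardinality \<open>f\<close> takes every nonzero value except
  \<open>\<kappa>\<close>, so Wilson's theorem applies once \<open>\<kappa>\<close> is put back. In
  the application \<open>\<kappa>\<close> is the slope of a tangent.\<close>

lemma prod_inj_nonzero_missing:
  fixes f :: "'a \<Rightarrow> 'k::{field,finite}"
  assumes "odd CARD('k)" "finite S" "inj_on f S" "\<And>x. x \<in> S \<Longrightarrow> f x \<noteq> 0"
    and "card S + 2 = CARD('k)" "\<kappa> \<noteq> 0" "\<And>x. x \<in> S \<Longrightarrow> f x \<noteq> \<kappa>"
  shows "\<kappa> * prod f S = -1"
proof -
  have "insert \<kappa> (f ` S) = UNIV - {0}"
  proof (intro card_subset_eq)
    have "card (insert \<kappa> (f ` S)) = Suc (card S)"
      using assms by (subst card_insert_disjoint) (auto simp: card_image)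
    then show "card (insert \<kappa> (f ` S)) = card (UNIV - {0::'k})" using assms(5) by simp
  qed (use assms in auto)
  then have "prod (\<lambda>x. x) (insert \<kappa> (f ` S)) = -1"
    using prod_nonzero_field[OF assms(1)] by simp
  moreover have "prod (\<lambda>x. x) (insert \<kappa> (f ` S)) = \<kappa> * prod (\<lambda>x. x) (f ` S)"
    using assms by (intro prod.insert) auto
  ultimately show ?thesis using prod.reindex[OF assms(3), of "\<lambda>x. x"] by (simp add: o_def)
qed

section \<open>Linear forms, cross products and determinants in three coordinates\<close>

definition dot :: "'a::comm_ring_1 ^ 'n \<Rightarrow> 'a ^ 'n \<Rightarrow> 'a" where
  "dot u v = (\<Sum>i\<in>UNIV. u $ i * v $ i)"

definition cross :: "'a::comm_ring_1 ^ 3 \<Rightarrow> 'a ^ 3 \<Rightarrow> 'a ^ 3" where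
  "cross u v = vector [u $ 2 * v $ 3 - u $ 3 * v $ 2, u $ 3 * v $ 1 - u $ 1 * v $ 3,
                       u $ 1 * v $ 2 - u $ 2 * v $ 1]"

definition triple :: "'a::comm_ring_1 ^ 3 \<Rightarrow> 'a ^ 3 \<Rightarrow> 'a ^ 3 \<Rightarrow> 'a" where
  "triple u v w = dot (cross u v) w"

lemma dot_3: "dot u v = u $ 1 * v $ 1 + u $ 2 * v $ 2 + u $ 3 * v $ (3::3)"
  by (simp add: dot_def sum_3)

lemma dot_commute: "dot u v = dot v u"
  by (simp add: dot_def mult.commute)

lemma dot_zero [simp]: "dot u 0 = 0" "dot 0 u = 0"
  by (simp_all add: dot_def)

lemma dot_add: "dot u (v + w) = dot u v + dot u w" "dot (v + w) u = dot v u + dot w u"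
  by (simp_all add: dot_def algebra_simps sum.distrib)

lemma dot_scale: "dot u (c *s v) = c * dot u v" "dot (c *s u) v = c * dot u v"
  by (simp_all add: dot_def sum_distrib_left algebra_simps)

lemma cross_nth:
  "cross u v $ 1 = u $ 2 * v $ 3 - u $ 3 * v $ 2"
  "cross u v $ 2 = u $ 3 * v $ 1 - u $ 1 * v $ 3"
  "cross u v $ 3 = u $ 1 * v $ 2 - u $ 2 * v $ 1"
  by (simp_all add: cross_def)

lemma triple_expand:
  "triple u v w = u $ 1 * (v $ 2 * w $ 3 - v $ 3 * w $ 2) + u $ 2 * (v $ 3 * w $ 1 - v $ 1 * w $ 3)
     + u $ 3 * (v $ 1 * w $ 2 - v $ 2 * w $ 1)"
  by (simp add: triple_def dot_3 cross_nth algebra_simps)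

lemma triple_rotate: "triple u v w = triple v w u"
  by (simp add: triple_expand algebra_simps)

lemma triple_swap: "triple u v w = - triple v u w"
  by (simp add: triple_expand algebra_simps)

lemma triple_same [simp]: "triple u u w = 0" "triple u w w = 0" "triple u w u = 0"
  by (simp_all add: triple_expand algebra_simps)

lemma triple_eq_det: "triple u v w = det (vector [u, v, w])"
  by (simp add: triple_expand det_3 algebra_simps)

text \<open>A suitable \<open>c\<close> is a nonzero kernel vector of the matrix with rows
  \<open>u\<close>, \<open>v\<close>, \<open>w\<close>. Geometrically it is a line through three
  points or, dually, a point on three lines.\<close>

lemma triple_eq_0_iff:
  fixes u v w :: "'a::field ^ 3"
  shows "triple u v w = 0 \<longleftrightarrow> (\<exists>c. c \<noteq> 0 \<and> dot c u = 0 \<and> dot c v = 0 \<and> dot c w = 0)"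
proof -
  let ?A = "vector [u, v, w] :: 'a ^ 3 ^ 3"
  have *: "?A *v c = 0 \<longleftrightarrow> dot c u = 0 \<and> dot c v = 0 \<and> dot c w = 0" for c
    by (simp add: vec_eq_iff forall_3 matrix_vector_mult_def dot_def mult.commute)
  have "triple u v w = 0 \<longleftrightarrow> \<not> invertible ?A"
    by (simp add: triple_eq_det invertible_det_nz)
  also have "\<dots> \<longleftrightarrow> \<not> (\<forall>x. ?A *v x = 0 \<longrightarrow> x = 0)"
    by (metis invertible_left_inverse matrix_left_invertible_ker)
  finally show ?thesis using * by auto
qed

text \<open>Cramer's rule: the brackets on the right are the coordinates of \<open>x\<close> in the
  frame \<open>p, q, r\<close>, scaled by the determinant of the frame. A linear form is thus known
  at \<open>x\<close> from its values on the frame.\<close>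

lemma cramer_dot:
  "triple p q r * dot c x = triple x q r * dot c p + triple p x r * dot c q + triple p q x * dot c r"
  by (simp add: triple_expand dot_3 algebra_simps)

text \<open>The three-term Grassmann-Pluecker relation, with \<open>p\<close> common to all
  brackets.\<close>

lemma triple_plucker:
  "triple p x r * triple p q y - triple p y r * triple p q x = triple p q r * triple p x y"
  by (simp add: triple_expand algebra_simps)

section \<open>Segre's theorem\<close>

definition vec_arc :: "('a::field ^ 3) set \<Rightarrow> bool" where
  "vec_arc S \<longleftrightarrow> (\<forall>u\<in>S. \<forall>v\<in>S. \<forall>w\<in>S. u \<noteq> v \<and> u \<noteq> w \<and> v \<noteq> w \<longrightarrow> triple u v w \<noteq> 0)"

lemma vec_arcD:
  "vec_arc S \<Longrightarrow> u \<in> S \<Longrightarrow> v \<in> S \<Longrightarrow> w \<in> S \<Longrightarrow> u \<noteq> v \<Longrightarrow> u \<noteq> w \<Longrightarrow> v \<noteq> w \<Longrightarrow> triple u v w \<noteq> 0"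
  by (auto simp: vec_arc_def)

lemma vec_arc_subset: "vec_arc S \<Longrightarrow> T \<subseteq> S \<Longrightarrow> vec_arc T"
  unfolding vec_arc_def by blast

lemma card_ge_3E:
  assumes "3 \<le> card S"
  obtains p q r where "p \<in> S" "q \<in> S" "r \<in> S" "p \<noteq> q" "p \<noteq> r" "q \<noteq> r"
proof -
  obtain T where T: "T \<subseteq> S" "card T = 3"
    using obtain_subset_with_card_n[OF assms] by metis
  then obtain p q r where "T = {p, q, r}" "p \<noteq> q" "p \<noteq> r" "q \<noteq> r"
    by (metis card_3_iff)
  with T that show thesis by auto
qed

lemma card_Diff_3:
  assumes "finite S" "p \<in> S" "q \<in> S" "r \<in> S" "p \<noteq> q" "p \<noteq> r" "q \<noteq> r"
  shows "card (S - {p, q, r}) = card S - 3"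
proof -
  have "card {p, q, r} = 3" using assms by simp
  then show ?thesis using assms by (subst card_Diff_subset) auto
qed

text \<open>The slope of the line \<open>px\<close> in the pencil at \<open>p\<close>: if
  \<open>x\<close> has coordinates X, Y, Z in the frame \<open>p, q, r\<close>, this is Y/Z.\<close>

definition ratio :: "'a::field ^ 3 \<Rightarrow> 'a ^ 3 \<Rightarrow> 'a ^ 3 \<Rightarrow> 'a ^ 3 \<Rightarrow> 'a" where
  "ratio p q r x = triple p x r / triple p q x"

lemma ratio_nonzero:
  assumes "vec_arc S" "p \<in> S" "q \<in> S" "r \<in> S" "p \<noteq> q" "p \<noteq> r" "x \<in> S - {p, q, r}"
  shows "ratio p q r x \<noteq> 0"
  using assms vec_arcD[OF assms(1), of p x r] vec_arcD[OF assms(1), of p q x]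
  by (auto simp: ratio_def)

text \<open>By the Pluecker relation, two points with equal slopes would be collinear with
  \<open>p\<close>.\<close>

lemma inj_on_ratio:
  assumes "vec_arc S" "p \<in> S" "q \<in> S" "r \<in> S" "p \<noteq> q" "p \<noteq> r" "q \<noteq> r"
  shows "inj_on (ratio p q r) (S - {p, q, r})"
proof (rule inj_onI, rule ccontr)
  fix x y
  assume x: "x \<in> S - {p, q, r}" and y: "y \<in> S - {p, q, r}"
    and eq: "ratio p q r x = ratio p q r y" and ne: "x \<noteq> y"
  have "triple p q x \<noteq> 0" "triple p q y \<noteq> 0"
    by (rule vec_arcD[OF assms(1)]; use x y assms in auto)+
  then have "triple p x r * triple p q y - triple p y r * triple p q x = 0"
    using eq by (simp add: ratio_def field_simps)
  then have "triple p q r * triple p x y = 0" by (simp only: triple_plucker)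
  moreover have "triple p q r \<noteq> 0" "triple p x y \<noteq> 0"
    by (rule vec_arcD[OF assms(1)]; use x y ne assms in auto)+
  ultimately show False by simp
qed

text \<open>In frame coordinates the three slopes are Y/Z, Z/X and X/Y.\<close>

lemma ratio_cycle:
  assumes "vec_arc S" "p \<in> S" "q \<in> S" "r \<in> S" "p \<noteq> q" "p \<noteq> r" "q \<noteq> r" "x \<in> S - {p, q, r}"
  shows "ratio p q r x * (ratio q r p x * ratio r p q x) = 1"
proof -
  have "triple p x r \<noteq> 0" "triple p q x \<noteq> 0" "triple x q r \<noteq> 0"
    by (rule vec_arcD[OF assms(1)]; use assms in auto)+
  moreover have "triple q x p = triple p q x" "triple q r x = triple x q r"
    "triple r x q = triple x q r" "triple r p x = triple p x r"
    by (simp_all add: triple_expand algebra_simps)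
  ultimately show ?thesis by (simp add: ratio_def)
qed

lemma prod_ratio_cycle:
  assumes "vec_arc S" "p \<in> S" "q \<in> S" "r \<in> S" "p \<noteq> q" "p \<noteq> r" "q \<noteq> r"
  shows "prod (ratio p q r) (S - {p, q, r}) * (prod (ratio q r p) (S - {q, r, p}) *
    prod (ratio r p q) (S - {r, p, q})) = 1"
proof -
  have "S - {q, r, p} = S - {p, q, r}" "S - {r, p, q} = S - {p, q, r}" by auto
  moreover have "(\<Prod>x\<in>S - {p, q, r}. ratio p q r x * (ratio q r p x * ratio r p q x)) = 1"
    using ratio_cycle[OF assms] by (intro prod.neutral) blast
  ultimately show ?thesis by (simp add: prod.distrib)
qed

text \<open>With \<open>CARD('k) + 2\<close> points, the slopes at each of \<open>p\<close>,
  \<open>q\<close>, \<open>r\<close> would run through all nonzero field elements. The three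
  products of slopes would each be -1, while their product is 1 by the cyclic relation; in odd
  characteristic this is absurd.\<close>

lemma vec_arc_card_le:
  fixes S :: "('k::{field,finite} ^ 3) set"
  assumes odd: "odd CARD('k)" and S: "vec_arc S"
  shows "card S \<le> CARD('k) + 1"
proof (rule ccontr)
  assume "\<not> ?thesis"
  then obtain T where T: "T \<subseteq> S" "card T = CARD('k) + 2"
    using obtain_subset_with_card_n[of "CARD('k) + 2" S] by (metis Suc_eq_plus1 add_Suc_right not_less_eq_eq numeral_2_eq_2 add_2_eq_Suc')
  have arc: "vec_arc T" using S T vec_arc_subset by blast
  have "3 \<le> card T" using T(2) card_odd_field_ge_3[OF odd] by simp
  then obtain p q r where pqr: "p \<in> T" "q \<in> T" "r \<in> T" "p \<noteq> q" "p \<noteq> r" "q \<noteq> r"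
    by (rule card_ge_3E)
  have *: "prod (ratio p q r) (T - {p, q, r}) = -1"
    if "p \<in> T" "q \<in> T" "r \<in> T" "p \<noteq> q" "p \<noteq> r" "q \<noteq> r" for p q r
    using odd
  proof (rule prod_inj_nonzero)
    show "card (T - {p, q, r}) = CARD('k) - 1"
      using card_Diff_3[OF _ that] T(2) by simp
    show "inj_on (ratio p q r) (T - {p, q, r})" using inj_on_ratio arc that by blast
    show "ratio p q r x \<noteq> 0" if "x \<in> T - {p, q, r}" for x
      using ratio_nonzero[OF arc] \<open>p \<in> T\<close> \<open>q \<in> T\<close> \<open>r \<in> T\<close> \<open>p \<noteq> q\<close> \<open>p \<noteq> r\<close> that by blast
  qed simp
  have "(-1::'k) * (-1 * -1) = 1"
    using prod_ratio_cycle[OF arc pqr] *[of p q r] *[of q r p] *[of r p q] pqr by metis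
  then have e: "(-1::'k) = 1" by (simp only: mult_minus1 minus_minus)
  have "(2::'k) = 1 - (-1)" by simp
  also have "\<dots> = 0" unfolding e by simp
  finally show False using two_neq_zero_odd_card[OF odd] by simp
qed

text \<open>
  The ratios of an oval at \<open>p\<close> take all nonzero values but one; the missing value is the slope
  of the tangent at \<open>p\<close>.
\<close>

lemma tangent_exists:
  fixes S :: "('k::{field,finite} ^ 3) set"
  assumes odd: "odd CARD('k)" and S: "vec_arc S" "card S = CARD('k) + 1" and p: "p \<in> S"
  shows "\<exists>c. dot c p = 0 \<and> (\<forall>x\<in>S - {p}. dot c x \<noteq> 0)"
proof -
  have card2: "2 \<le> card (S - {p})"
    using S p card_odd_field_ge_3[OF odd] by (simp add: card_Diff_singleton)
  then obtain T where "T \<subseteq> S - {p}" "card T = 2" by (metis obtain_subset_with_card_n)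
  then obtain q r where qr: "q \<in> S" "r \<in> S" "p \<noteq> q" "p \<noteq> r" "q \<noteq> r"
    by (auto simp: card_2_iff)
  let ?S = "S - {p, q, r}"
  have "card (ratio p q r ` ?S) = CARD('k) - 2"
    using card_image[OF inj_on_ratio[OF S(1) p qr]] card_Diff_3[OF _ p qr] S(2) by simp
  \<comment> \<open>The \<open>CARD('k) - 2\<close> slopes of the secants and the value 0 do not
    fill the field, so a nonzero slope remains free.\<close>
  then have "card (insert 0 (ratio p q r ` ?S)) < CARD('k)"
    using card_insert_le_m1[of "CARD('k) - 1" "ratio p q r ` ?S" 0] card_odd_field_ge_3[OF odd] by linarith
  then have "insert 0 (ratio p q r ` ?S) \<noteq> UNIV" by auto
  then obtain \<kappa> where \<kappa>: "\<kappa> \<noteq> 0" "\<kappa> \<notin> ratio p q r ` ?S" by blast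
  \<comment> \<open>The linear form of the line through \<open>p\<close> with slope
    \<open>\<kappa>\<close>.\<close>
  define c where "c = cross r p - \<kappa> *s cross p q"
  have c: "dot c x = triple p x r - \<kappa> * triple p q x" for x
    by (simp add: c_def triple_expand dot_3 cross_nth algebra_simps)
  have D: "triple p q r \<noteq> 0" by (rule vec_arcD[OF S(1)]) (use p qr in auto)
  have "dot c x \<noteq> 0" if "x \<in> S - {p}" for x
  proof (cases "x = q \<or> x = r")
    case True
    then show ?thesis using D \<kappa> by (auto simp: c)
  next
    case False
    then have x: "x \<in> ?S" using that by auto
    then have "triple p q x \<noteq> 0" by (intro vec_arcD[OF S(1)]) (use p qr in auto)
    moreover have "ratio p q r x \<noteq> \<kappa>" using x \<kappa> by blast
    ultimately show ?thesis by (auto simp: c ratio_def field_simps)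
  qed
  moreover have "dot c p = 0" by (simp add: c)
  ultimately show ?thesis by blast
qed

text \<open>Segre's lemma of tangents. At each of the three points, the slopes of the secants
  together with the slope of the tangent are all the nonzero field elements, with product -1.
  Multiplying the three identities cancels the secants by the cyclic relation and leaves a relation
  between the tangents alone.\<close>

lemma lemma_of_tangents:
  fixes S :: "('k::{field,finite} ^ 3) set"
  assumes odd: "odd CARD('k)" and S: "vec_arc S" "card S = CARD('k) + 1"
    and c: "\<And>p. p \<in> S \<Longrightarrow> dot (c p) p = 0" "\<And>p x. p \<in> S \<Longrightarrow> x \<in> S \<Longrightarrow> x \<noteq> p \<Longrightarrow> dot (c p) x \<noteq> 0"
    and pqr: "p \<in> S" "q \<in> S" "r \<in> S" "p \<noteq> q" "p \<noteq> r" "q \<noteq> r"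
  shows "dot (c p) r * dot (c q) p * dot (c r) q = dot (c p) q * dot (c q) r * dot (c r) p"
proof -
  \<comment> \<open>The first factor is the slope of the tangent: as \<open>c p\<close> vanishes at
    \<open>p\<close>, its zeros satisfy Y (c p)(q) + Z (c p)(r) = 0 in frame coordinates.\<close>
  have *: "- (dot (c p) r / dot (c p) q) * prod (ratio p q r) (S - {p, q, r}) = -1"
    if pqr: "p \<in> S" "q \<in> S" "r \<in> S" "p \<noteq> q" "p \<noteq> r" "q \<noteq> r" for p q r
    using odd
  proof (rule prod_inj_nonzero_missing)
    show "card (S - {p, q, r}) + 2 = CARD('k)"
      using card_Diff_3[OF _ that] S(2) card_mono[of S "{p, q, r}"] pqr by simp
    show "inj_on (ratio p q r) (S - {p, q, r})" using inj_on_ratio S pqr by blast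
    fix x assume x: "x \<in> S - {p, q, r}"
    show "ratio p q r x \<noteq> 0" using ratio_nonzero[OF S(1)] pqr x by blast
    show "ratio p q r x \<noteq> - (dot (c p) r / dot (c p) q)"
    proof
      assume eq: "ratio p q r x = - (dot (c p) r / dot (c p) q)"
      have nz: "triple p q x \<noteq> 0" "triple p q r \<noteq> 0"
        by (rule vec_arcD[OF S(1)]; use pqr x in auto)+
      have nz': "dot (c p) q \<noteq> 0" "dot (c p) x \<noteq> 0"
        using c pqr x by auto
      have "triple p x r / triple p q x = - dot (c p) r / dot (c p) q"
        using eq by (simp add: ratio_def)
      then have "triple p x r * dot (c p) q = - dot (c p) r * triple p q x"
        using nz nz' frac_eq_eq by metis
      then have "triple p q r * dot (c p) x = 0"
        unfolding cramer_dot[of p q r] c(1)[OF pqr(1)] by simp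
      then show False using nz nz' by simp
    qed
  qed (use c pqr in auto)
  let ?a = "prod (ratio p q r) (S - {p, q, r})"
  let ?b = "prod (ratio q r p) (S - {q, r, p})"
  let ?d = "prod (ratio r p q) (S - {r, p, q})"
  have "?a * (?b * ?d) = 1" using prod_ratio_cycle S pqr by blast
  moreover have "(- (dot (c p) r / dot (c p) q) * ?a) * (- (dot (c q) p / dot (c q) r) * ?b) *
      (- (dot (c r) q / dot (c r) p) * ?d) = -1"
    using *[of p q r] *[of q r p] *[of r p q] pqr by simp
  ultimately have "(dot (c p) r / dot (c p) q) * (dot (c q) p / dot (c q) r) * (dot (c r) q / dot (c r) p) = 1"
    by (simp only: minus_mult_left[symmetric] minus_mult_right[symmetric] minus_minus mult_ac) simp
  moreover have "dot (c p) q \<noteq> 0" "dot (c q) r \<noteq> 0" "dot (c r) p \<noteq> 0"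
    using c pqr by auto
  ultimately show ?thesis by (simp add: field_simps)
qed

section \<open>Quadratic forms and the conic through an oval\<close>

definition quad :: "'a::comm_ring_1 ^ 'n ^ 'n \<Rightarrow> 'a ^ 'n \<Rightarrow> 'a" where
  "quad A x = (\<Sum>i\<in>UNIV. \<Sum>j\<in>UNIV. A $ i $ j * x $ i * x $ j)"

lemma quad_scale: "quad A (c *s x) = c * c * quad A x"
  by (simp add: quad_def sum_distrib_left algebra_simps)

lemma quad_eq_dot: "quad A x = dot x (A *v x)"
  by (simp add: quad_def dot_def matrix_vector_mult_def sum_distrib_left algebra_simps)

lemma dot_vector_matrix_mult: "dot x (y v* N) = dot (N *v x) y"
  by (simp add: dot_def matrix_vector_mult_def vector_matrix_mult_def sum_distrib_left
      sum_distrib_right algebra_simps) (rule sum.swap)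

lemma quad_congruent: "quad (transpose N ** M ** N) x = quad M (N *v x)"
  by (simp add: quad_eq_dot matrix_vector_mul_assoc[symmetric] dot_vector_matrix_mult)

text \<open>The rescaled tangent forms yield a function \<open>T\<close> that is symmetric on
  \<open>S\<close>, linear in its second argument and zero on the diagonal. Expanding
  \<open>T x x = 0\<close> in a frame of three points of \<open>S\<close>, once in each argument,
  gives a quadratic equation whose coefficients do not depend on \<open>x\<close>.\<close>

theorem segre:
  fixes S :: "('k::{field,finite} ^ 3) set"
  assumes odd: "odd CARD('k)" and S: "vec_arc S" "card S = CARD('k) + 1"
  shows "\<exists>A :: 'k ^ 3 ^ 3. transpose A = A \<and> det A \<noteq> 0 \<and> (\<forall>x\<in>S. quad A x = 0)"
proof -
  have two: "(2::'k) \<noteq> 0" using odd by (rule two_neq_zero_odd_card)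
  obtain c where c: "\<And>p. p \<in> S \<Longrightarrow> dot (c p) p = 0"
      "\<And>p x. p \<in> S \<Longrightarrow> x \<in> S \<Longrightarrow> x \<noteq> p \<Longrightarrow> dot (c p) x \<noteq> 0"
    using tangent_exists[OF odd S] by (metis Diff_iff empty_iff insert_iff)
  have "3 \<le> card S" using S(2) card_odd_field_ge_3[OF odd] by simp
  then obtain p q r where pqr: "p \<in> S" "q \<in> S" "r \<in> S" "p \<noteq> q" "p \<noteq> r" "q \<noteq> r"
    by (rule card_ge_3E)
  text \<open>Rescaling the tangents so that they agree with the one at \<open>p\<close> makes them symmetric.\<close>
  define T where "T x = dot ((if x = p then 1 else dot (c p) x / dot (c x) p) *s c x)" for x
  have T_sym: "T x y = T y x" if "x \<in> S" "y \<in> S" for x y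
  proof -
    consider "x = y" | "x = p" "y \<noteq> p" | "x \<noteq> p" "y = p" | "x \<noteq> p" "y \<noteq> p" "x \<noteq> y" by blast
    then show ?thesis
    proof cases
      case 4
      have "dot (c x) p \<noteq> 0" "dot (c y) p \<noteq> 0" using 4 c that pqr by auto
      moreover have "dot (c p) y * dot (c x) p * dot (c y) x = dot (c p) x * dot (c x) y * dot (c y) p"
        using lemma_of_tangents[OF odd S c, of p x y] that pqr 4 by auto
      ultimately show ?thesis using 4 by (simp add: T_def dot_scale field_simps)
    qed (use c that pqr in \<open>auto simp: T_def dot_scale\<close>)
  qed
  have T_self: "T x x = 0" if "x \<in> S" for x using c(1)[OF that] by (auto simp: T_def dot_scale)
  have T_nz: "T x y \<noteq> 0" if "x \<in> S" "y \<in> S" "x \<noteq> y" for x y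
    using c that pqr by (auto simp: T_def dot_scale)
  have T_cramer: "triple p q r * T x y = triple y q r * T x p + triple p y r * T x q + triple p q y * T x r" for x y
    unfolding T_def by (rule cramer_dot)
  define D where "D = triple p q r"
  have D: "D \<noteq> 0" unfolding D_def by (rule vec_arcD[OF S(1)]) (use pqr in auto)
  \<comment> \<open>\<open>N\<close> sends a vector to its Cramer coordinates in the frame
    \<open>p, q, r\<close>, and \<open>M\<close> is the table of values of \<open>T\<close> on the
    frame. Hence \<open>A\<close> is the form of \<open>M\<close> pulled back to the original
    coordinates.\<close>
  define N where "N = (vector [cross q r, cross r p, cross p q] :: 'k ^ 3 ^ 3)"
  define M where "M = (vector [vector [0, T p q, T p r], vector [T p q, 0, T q r], vector [T p r, T q r, 0]] :: 'k ^ 3 ^ 3)"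
  define A where "A = transpose N ** M ** N"
  have N: "N *v x = vector [triple x q r, triple p x r, triple p q x]" for x
    by (simp add: N_def vec_eq_iff forall_3 matrix_vector_mult_def sum_3 triple_expand cross_nth algebra_simps)
  have "transpose M = M" by (simp add: M_def vec_eq_iff forall_3 transpose_def)
  then have "transpose A = A" by (simp add: A_def matrix_transpose_mul transpose_transpose matrix_mul_assoc)
  moreover have "det A \<noteq> 0"
  proof -
    have "det M = 2 * (T p q * (T p r * T q r))" by (simp add: M_def det_3 algebra_simps)
    then have "det M \<noteq> 0" using two T_nz pqr by simp
    moreover have "N *v x = 0 \<longrightarrow> x = 0" for x
    proof
      assume "N *v x = 0"
      then have "triple x q r = 0" "triple p x r = 0" "triple p q x = 0"
        using N[of x] by (simp_all add: vec_eq_iff forall_3)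
      then have "D * dot e x = 0" for e using cramer_dot[of p q r e x] by (simp add: D_def)
      then have "dot e x = 0" for e using D by simp
      from this[of "axis 1 1"] this[of "axis 2 1"] this[of "axis 3 1"]
      show "x = 0" by (simp add: dot_3 vec_eq_iff forall_3 axis_def)
    qed
    then have "det N \<noteq> 0"
      by (metis invertible_det_nz invertible_left_inverse matrix_left_invertible_ker)
    ultimately show ?thesis by (simp add: A_def det_mul det_transpose)
  qed
  moreover have "quad A x = 0" if x: "x \<in> S" for x
  proof -
    let ?x = "triple x q r" and ?y = "triple p x r" and ?z = "triple p q x"
    \<comment> \<open>Each of the two factors \<open>D\<close> pays for one application of Cramer's
      rule.\<close>
    have "0 = D * (D * T x x)" using T_self x by simp
    also have "D * T x x = ?x * T p x + ?y * T q x + ?z * T r x"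
      unfolding D_def using T_cramer[of x x] T_sym[OF x] pqr by simp
    also have "D * \<dots> = ?x * (D * T p x) + ?y * (D * T q x) + ?z * (D * T r x)"
      by (simp add: algebra_simps)
    also have "\<dots> = ?x * (?y * T p q + ?z * T p r) + ?y * (?x * T p q + ?z * T q r) + ?z * (?x * T p r + ?y * T q r)"
      unfolding D_def T_cramer using T_self T_sym[of q p] T_sym[of r p] T_sym[of r q] pqr by simp
    also have "\<dots> = quad A x"
      unfolding A_def quad_congruent N by (simp add: quad_def sum_3 M_def algebra_simps)
    finally show ?thesis by simp
  qed
  ultimately show ?thesis by blast
qed

section \<open>Planar arcs\<close>

lemma proj_point_iff: "P \<in> proj_points \<longleftrightarrow> (\<exists>v. v \<noteq> 0 \<and> P = vec.span {v})"
proof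
  assume "P \<in> proj_points"
  then have P: "vec.subspace P" "vec.dim P = 1" by (auto simp: proj_points_def)
  obtain B where B: "B \<subseteq> P" "vec.independent B" "P \<subseteq> vec.span B" "card B = vec.dim P"
    using vec.basis_exists by blast
  then obtain v where v: "B = {v}" using P by (metis card_1_singletonE)
  then have "P = vec.span {v}" using B P by (metis vec.span_minimal subset_antisym)
  moreover have "v \<noteq> 0" using B v vec.dependent_zero by blast
  ultimately show "\<exists>v. v \<noteq> 0 \<and> P = vec.span {v}" by blast
qed (auto simp: proj_points_def)

lemma span_singleton_in_proj_points: "v \<noteq> 0 \<Longrightarrow> vec.span {v} \<in> proj_points"
  by (auto simp: proj_point_iff)

text \<open>Choosing a spanning vector for each point turns arcs of points into arcs of vectors,
  where collinearity is the vanishing of a determinant.\<close>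

definition rep :: "('k::field ^ 'n) set \<Rightarrow> 'k ^ 'n" where
  "rep P = (SOME v. v \<noteq> 0 \<and> P = vec.span {v})"

lemma rep: "P \<in> proj_points \<Longrightarrow> rep P \<noteq> 0 \<and> P = vec.span {rep P}"
  unfolding proj_point_iff rep_def by (rule someI_ex)

lemma inj_on_rep: "inj_on rep proj_points"
  by (metis inj_onI rep)

lemma dot_diff: "dot u (v - w) = dot u v - dot u w"
  by (simp add: dot_def algebra_simps sum_subtractf)

lemma subspace_dot_eq_0: "vec.subspace {x. dot c x = 0}"
  by (auto simp: vec.subspace_def dot_add dot_scale)

lemma dot_axis: "dot c (axis i 1) = c $ i"
  by (simp add: dot_def axis_def if_distrib cong: if_cong)

lemma dot_eq_0_all: "(\<And>x. dot c x = 0) \<Longrightarrow> c = 0"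
  by (metis dot_axis vec_eq_iff zero_index)

text \<open>Modulo the kernel, every vector is a multiple of one fixed vector \<open>d\<close>
  outside it.\<close>

lemma dim_dot_eq_0:
  fixes c :: "'k::field ^ 'n"
  assumes "c \<noteq> 0"
  shows "vec.dim {x. dot c x = 0} + 1 = CARD('n)"
proof -
  let ?l = "{x. dot c x = 0}"
  obtain d where d: "dot c d \<noteq> 0" using assms dot_eq_0_all by blast
  have span: "vec.span ?l = ?l" using subspace_dot_eq_0 by (rule vec.span_eq_iff[THEN iffD2])
  have "x \<in> vec.span (insert d ?l)" for x
  proof -
    have "x - (dot c x / dot c d) *s d \<in> ?l"
      using d by (simp add: dot_diff dot_scale)
    then show ?thesis unfolding vec.span_insert span by blast
  qed
  then have "vec.dim (insert d ?l) = CARD('n)"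
    using vec.dim_eq_full[of "insert d ?l"] by (auto simp: vec.dimension_def card_cart_basis)
  then show ?thesis using d span by (simp add: vec.dim_insert)
qed

text \<open>A linear map that kills a basis of \<open>U\<close> and fixes \<open>x\<close> exists
  because \<open>x\<close> is independent of that basis; a coordinate in which \<open>x\<close> is
  nonzero turns it into the form \<open>c\<close>.\<close>

lemma separating_functional:
  fixes U :: "('k::field ^ 'n) set"
  assumes U: "vec.subspace U" and x: "x \<notin> U"
  shows "\<exists>c. (\<forall>u\<in>U. dot c u = 0) \<and> dot c x \<noteq> 0"
proof -
  obtain B where B: "B \<subseteq> U" "vec.independent B" "U \<subseteq> vec.span B"
    by (rule vec.basis_exists[of U])
  have span: "vec.span B = U" using B U by (metis vec.span_minimal subset_antisym)
  have indep: "vec.independent (insert x B)" using B x span by (simp add: vec.independent_insert)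
  obtain f :: "'k ^ 'n \<Rightarrow> 'k ^ 'n" where f: "Vector_Spaces.linear (*s) (*s) f"
      "\<And>b. b \<in> insert x B \<Longrightarrow> f b = (if b = x then x else 0)"
    using vec.linear_independent_extend[OF indep, of "\<lambda>b. if b = x then x else 0"] by blast
  have "x \<noteq> 0" using x U vec.subspace_0 by metis
  then obtain i where i: "x $ i \<noteq> 0" by (metis vec_eq_iff zero_index)
  define c where "c = row i (matrix f)"
  have c: "dot c y = f y $ i" for y
    unfolding matrix_works[OF f(1), symmetric, of y]
    by (simp add: c_def dot_def row_def matrix_vector_mult_def)
  have "B \<subseteq> {y. dot c y = 0}" using f(2) B(1) x by (auto simp: c)
  then have "U \<subseteq> {y. dot c y = 0}" using subspace_dot_eq_0 span vec.span_minimal by blast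
  moreover have "dot c x \<noteq> 0" using i f(2)[of x] by (simp add: c)
  ultimately show ?thesis by blast
qed

text \<open>Both directions pass through a linear form vanishing on the three vectors: a
  2-dimensional subspace is annihilated by a nonzero form, and the kernel of a nonzero form has
  dimension 2.\<close>

lemma collinear3_span_iff:
  fixes u v w :: "'k::field ^ 3"
  shows "collinear3 (vec.span {u}) (vec.span {v}) (vec.span {w}) \<longleftrightarrow> triple u v w = 0"
proof
  assume "collinear3 (vec.span {u}) (vec.span {v}) (vec.span {w})"
  then obtain l where l: "vec.subspace l" "vec.dim l = 2" "u \<in> l" "v \<in> l" "w \<in> l"
    unfolding collinear3_def by (meson insertI1 subsetD vec.span_base)
  then have "l \<noteq> UNIV" by (auto simp: card_cart_basis)
  then obtain x where "x \<notin> l" by auto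
  then obtain c where "\<forall>u\<in>l. dot c u = 0" "dot c x \<noteq> 0" using separating_functional l by metis
  then show "triple u v w = 0" unfolding triple_eq_0_iff using l by (intro exI[of _ c]) auto
next
  assume "triple u v w = 0"
  then obtain c where c: "c \<noteq> 0" "dot c u = 0" "dot c v = 0" "dot c w = 0"
    unfolding triple_eq_0_iff by auto
  then show "collinear3 (vec.span {u}) (vec.span {v}) (vec.span {w})"
    unfolding collinear3_def using dim_dot_eq_0[OF c(1)] subspace_dot_eq_0[of c]
    by (intro exI[of _ "{x. dot c x = 0}"]) (auto simp: vec.span_singleton dot_scale c)
qed

lemma vec_arc_rep:
  assumes "planar_arc A"
  shows "vec_arc (rep ` A)"
  unfolding vec_arc_def
proof (intro ballI impI)
  fix u v w assume "u \<in> rep ` A" "v \<in> rep ` A" "w \<in> rep ` A" and ne: "u \<noteq> v \<and> u \<noteq> w \<and> v \<noteq> w"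
  then obtain P Q R where PQR: "P \<in> A" "Q \<in> A" "R \<in> A" "u = rep P" "v = rep Q" "w = rep R" by blast
  then have "\<not> collinear3 P Q R" using assms ne unfolding planar_arc_def by metis
  moreover have "P = vec.span {u}" "Q = vec.span {v}" "R = vec.span {w}"
    using PQR assms rep by (auto simp: planar_arc_def)
  ultimately show "triple u v w \<noteq> 0" using collinear3_span_iff by metis
qed

lemma card_rep:
  assumes "planar_arc A"
  shows "card (rep ` A) = card A"
  using assms inj_on_rep unfolding planar_arc_def by (metis card_image inj_on_subset)

lemma planar_arc_span:
  assumes "vec_arc S" "0 \<notin> S"
  shows "planar_arc ((\<lambda>v. vec.span {v}) ` S)"
  unfolding planar_arc_def
proof (intro conjI ballI impI)
  show "(\<lambda>v. vec.span {v}) ` S \<subseteq> proj_points"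
    using assms(2) by (auto intro!: span_singleton_in_proj_points)
  fix P Q R assume "P \<in> (\<lambda>v. vec.span {v}) ` S" "Q \<in> (\<lambda>v. vec.span {v}) ` S" "R \<in> (\<lambda>v. vec.span {v}) ` S"
    and ne: "P \<noteq> Q \<and> P \<noteq> R \<and> Q \<noteq> R"
  then obtain u v w where "u \<in> S" "v \<in> S" "w \<in> S" "P = vec.span {u}" "Q = vec.span {v}" "R = vec.span {w}"
    by blast
  moreover from this have "triple u v w \<noteq> 0" by (intro vec_arcD[OF assms(1)]) (use ne in blast)+
  ultimately show "\<not> collinear3 P Q R" by (simp add: collinear3_span_iff)
qed

lemma planar_arc_card_le:
  fixes A :: "('k::{field,finite} ^ 3) set set"
  assumes "odd CARD('k)" "planar_arc A"
  shows "card A \<le> CARD('k) + 1"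
  using vec_arc_card_le[OF assms(1) vec_arc_rep[OF assms(2)]] card_rep[OF assms(2)] by simp

lemma planar_arc_segre:
  fixes A :: "('k::{field,finite} ^ 3) set set"
  assumes "odd CARD('k)" "planar_arc A" "card A = CARD('k) + 1"
  shows "\<exists>M :: 'k ^ 3 ^ 3. transpose M = M \<and> det M \<noteq> 0 \<and> (\<forall>P\<in>A. \<forall>x\<in>P. quad M x = 0)"
proof -
  obtain M :: "'k ^ 3 ^ 3" where M: "transpose M = M" "det M \<noteq> 0" "\<forall>x\<in>rep ` A. quad M x = 0"
    using segre[OF assms(1) vec_arc_rep[OF assms(2)]] card_rep[OF assms(2)] assms(3) by metis
  have "quad M x = 0" if "P \<in> A" "x \<in> P" for P x
  proof -
    have "P = vec.span {rep P}" using assms(2) that rep by (auto simp: planar_arc_def)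
    then obtain c where "x = c *s rep P" using \<open>x \<in> P\<close> vec.span_singleton by blast
    then show ?thesis using M(3) \<open>P \<in> A\<close> by (simp add: quad_scale)
  qed
  then show ?thesis using M by blast
qed

section \<open>Complete arcs, the number \<open>m2'\<close> and the standard conic\<close>

lemma complete_arc_extends:
  fixes A :: "('k::{field,finite} ^ 3) set set"
  assumes "planar_arc A"
  shows "\<exists>B. complete_arc B \<and> A \<subseteq> B"
proof -
  let ?X = "{B. planar_arc B \<and> A \<subseteq> B}"
  have "finite ?X" "?X \<noteq> {}" using assms by auto
  from finite_has_maximal[OF this] obtain B where "B \<in> ?X" "\<forall>C\<in>?X. B \<subseteq> C \<longrightarrow> B = C" by blast
  then show ?thesis unfolding complete_arc_def by (intro exI[of _ B]) auto
qed

lemma inj_on_span_singleton: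
  assumes "\<And>u v c. u \<in> S \<Longrightarrow> v \<in> S \<Longrightarrow> u = c *s v \<Longrightarrow> u = v"
  shows "inj_on (\<lambda>v. vec.span {v}) S"
proof (rule inj_onI)
  fix u v assume uv: "u \<in> S" "v \<in> S" "vec.span {u} = vec.span {v}"
  then have "u \<in> vec.span {v}" by (metis insertI1 vec.span_base)
  then show "u = v" using assms uv by (auto simp: vec.span_singleton)
qed

text \<open>One vector for each point of the conic x1 x3 = x2^2; the vector (0, 0, 1) belongs to the
  parameter infinity.\<close>

definition conic_vecs :: "('k::field ^ 3) set" where
  "conic_vecs = insert (vector [0, 0, 1]) (range (\<lambda>t. vector [1, t, t * t]))"

text \<open>The determinant of three affine points is a Vandermonde determinant; with the point at
  infinity it is a difference of two parameters, up to sign.\<close>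

lemma vec_arc_conic: "vec_arc (conic_vecs :: ('k::field ^ 3) set)"
proof -
  have 1: "triple (vector [1, a, a * a]) (vector [1, b, b * b]) (vector [1, c, c * c]) = (b - a) * (c - a) * (c - b)"
    for a b c :: 'k
    by (simp add: triple_expand algebra_simps)
  have 2: "triple (vector [0, 0, 1]) (vector [1, b, b * b]) (vector [1, c, c * c]) = c - b"
      "triple (vector [1, b, b * b]) (vector [0, 0, 1]) (vector [1, c, c * c]) = b - c"
      "triple (vector [1, b, b * b]) (vector [1, c, c * c]) (vector [0, 0, 1]) = c - b"
    for b c :: 'k
    by (simp_all add: triple_expand algebra_simps)
  show ?thesis unfolding vec_arc_def conic_vecs_def by (auto simp: 1 2)
qed

lemma zero_notin_conic_vecs: "0 \<notin> conic_vecs"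
  by (auto simp: conic_vecs_def vec_eq_iff forall_3)

lemma inj_on_span_conic_vecs: "inj_on (\<lambda>v. vec.span {v}) conic_vecs"
  by (rule inj_on_span_singleton) (auto simp: conic_vecs_def vec_eq_iff forall_3)

lemma card_conic_vecs: "card (conic_vecs :: ('k::{field,finite} ^ 3) set) = CARD('k) + 1"
proof -
  have "inj (\<lambda>t::'k. vector [1, t, t * t] :: 'k ^ 3)"
    by (rule injI) (auto simp: vec_eq_iff forall_3)
  then have "card (range (\<lambda>t::'k. vector [1, t, t * t] :: 'k ^ 3)) = CARD('k)"
    by (rule card_image)
  then show ?thesis unfolding conic_vecs_def
    by (subst card_insert_disjoint) (auto simp: vec_eq_iff forall_3)
qed

text \<open>The standard conic attains the upper bound for arcs, so its completion has the maximal
  size.\<close>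

lemma Max_complete_arc_sizes:
  assumes "odd CARD('k::{field,finite})"
  shows "Max (complete_arc_sizes TYPE('k)) = CARD('k) + 1"
proof (rule Max_eqI)
  show "finite (complete_arc_sizes TYPE('k))" by (simp add: complete_arc_sizes_def)
  show "k \<le> CARD('k) + 1" if "k \<in> complete_arc_sizes TYPE('k)" for k
    using that planar_arc_card_le[OF assms] by (auto simp: complete_arc_sizes_def complete_arc_def)
  let ?C = "(\<lambda>v. vec.span {v}) ` (conic_vecs :: ('k ^ 3) set)"
  obtain B where B: "complete_arc B" "?C \<subseteq> B"
    using complete_arc_extends[OF planar_arc_span[OF vec_arc_conic zero_notin_conic_vecs]] by blast
  have "card ?C = CARD('k) + 1"
    using card_image[OF inj_on_span_conic_vecs] card_conic_vecs by metis
  then have "CARD('k) + 1 \<le> card B" using B(2) by (metis card_mono finite)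
  moreover have "card B \<le> CARD('k) + 1"
    using B(1) planar_arc_card_le[OF assms] by (auto simp: complete_arc_def)
  ultimately show "CARD('k) + 1 \<in> complete_arc_sizes TYPE('k)"
    using B(1) by (auto simp: complete_arc_sizes_def intro!: exI[of _ B])
qed

text \<open>The size of \<open>A\<close> witnesses that the set in the definition of
  \<open>m2'\<close> is nonempty, so the default value 0 does not arise.\<close>

lemma le_m2':
  assumes "complete_arc (A :: ('k::{field,finite} ^ 3) set set)" "card A < Max (complete_arc_sizes TYPE('k))"
  shows "card A \<le> m2' TYPE('k)"
proof -
  let ?S = "{k \<in> complete_arc_sizes TYPE('k). k < Max (complete_arc_sizes TYPE('k))}"
  have "card A \<in> ?S" using assms by (auto simp: complete_arc_sizes_def)
  moreover have "finite ?S" by (simp add: complete_arc_sizes_def)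
  ultimately show ?thesis by (auto simp: m2'_def Let_def)
qed

text \<open>A completion of \<open>A\<close> is larger than the second largest size, hence has
  \<open>CARD('k) + 1\<close> points, and Segre's theorem applies to it.\<close>

lemma large_arc_on_conic:
  fixes A :: "('k::{field,finite} ^ 3) set set"
  assumes odd: "odd CARD('k)" and A: "planar_arc A" "m2' TYPE('k) < card A"
  shows "\<exists>M :: 'k ^ 3 ^ 3. transpose M = M \<and> det M \<noteq> 0 \<and> (\<forall>P\<in>A. \<forall>x\<in>P. quad M x = 0)"
proof -
  obtain B where B: "complete_arc B" "A \<subseteq> B" using complete_arc_extends[OF A(1)] by blast
  have "m2' TYPE('k) < card B" using A(2) B(2) by (meson card_mono finite less_le_trans)
  then have "\<not> card B < CARD('k) + 1"
    using le_m2'[OF B(1)] Max_complete_arc_sizes[OF odd] by auto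
  moreover have "planar_arc B" using B by (simp add: complete_arc_def)
  ultimately have "card B = CARD('k) + 1" using planar_arc_card_le[OF odd] by (metis le_neq_implies_less)
  from planar_arc_segre[OF odd \<open>planar_arc B\<close> this] show ?thesis using B(2) by blast
qed

lemma vec_arc_insert:
  assumes "vec_arc T" "\<And>u v. u \<in> T \<Longrightarrow> v \<in> T \<Longrightarrow> u \<noteq> v \<Longrightarrow> triple w u v \<noteq> 0"
  shows "vec_arc (insert w T)"
proof -
  have "triple u w v \<noteq> 0 \<and> triple u v w \<noteq> 0" if "u \<in> T" "v \<in> T" "u \<noteq> v" for u v
    using assms(2)[OF that] by (metis triple_swap triple_rotate neg_equal_0_iff_equal)
  then show ?thesis using assms unfolding vec_arc_def by auto
qed

text \<open>At most five values are forbidden at each choice. The result is that 1,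
  \<open>s\<close>, \<open>t\<close> have distinct nonzero squares.\<close>

lemma square_inequivalent_triple:
  assumes "7 \<le> CARD('k::{field,finite})"
  obtains s t :: "'k::{field,finite}" where "s \<noteq> 0" "s \<noteq> 1" "s \<noteq> -1" "t \<noteq> 0" "t \<noteq> 1" "t \<noteq> -1" "t \<noteq> s" "t \<noteq> - s"
proof -
  have *: "\<exists>x. x \<notin> S" if "finite S" "card S < 7" for S :: "'k set"
    using assms that by (metis UNIV_I not_le subsetI top.extremum_uniqueI)
  have "card {0, 1, -1::'k} < 7" by (rule le_less_trans[OF card_insert_le_m1[of 3]]) (auto simp: card_insert_if)
  then obtain s :: 'k where s: "s \<notin> {0, 1, -1}" using *[of "{0, 1, -1}"] by blast
  have "card {0, 1, -1, s, -s} < 7" by (auto simp: card_insert_if)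
  then obtain t where "t \<notin> {0, 1, -1, s, -s}" using *[of "{0, 1, -1, s, -s}"] by blast
  with s that show thesis by blast
qed

text \<open>
  The pole \<open>(0, 1, 0)\<close> of the line \<open>x\<^sub>2 = 0\<close> lies on the secant through \<open>(1, s, s\<^sup>2)\<close> and
  \<open>(1, t, t\<^sup>2)\<close> iff \<open>s\<^sup>2 = t\<^sup>2\<close>, so it forms an arc with five points of the conic \<open>x\<^sub>1 x\<^sub>3 = x\<^sub>2\<^sup>2\<close> having distinct
  \<open>t\<^sup>2\<close>. Since five points determine the conic, no oval contains this arc.
\<close>

lemma six_le_m2':
  assumes odd: "odd CARD('k::{field,finite})" and ge: "7 \<le> CARD('k)"
  shows "6 \<le> m2' TYPE('k)"
proof -
  obtain s t :: 'k where st: "s \<noteq> 0" "s \<noteq> 1" "s \<noteq> -1" "t \<noteq> 0" "t \<noteq> 1" "t \<noteq> -1" "t \<noteq> s" "t \<noteq> - s"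
    using square_inequivalent_triple[OF ge] by blast
  \<comment> \<open>The points of the standard conic with parameters 0, infinity, 1,
    \<open>s\<close> and \<open>t\<close>.\<close>
  define T where "T = {vector [1, 0, 0], vector [0, 0, 1], vector [1, 1, 1],
    vector [1, s, s * s], vector [1, t, t * t] :: 'k ^ 3}"
  define S where "S = insert (vector [0, 1, 0]) T"
  have sq: "s * s \<noteq> 1" "t * t \<noteq> 1" "t * t \<noteq> s * s"
    using st by (auto simp: square_eq_1_iff square_eq_iff)
  have arc: "vec_arc S"
    unfolding S_def
  proof (rule vec_arc_insert)
    have "(vector [1, 0, 0] :: 'k ^ 3) = vector [1, 0, 0 * 0]" "(vector [1, 1, 1] :: 'k ^ 3) = vector [1, 1, 1 * 1]"
      by simp_all
    then have "T \<subseteq> conic_vecs" unfolding T_def conic_vecs_def by blast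
    then show "vec_arc T" using vec_arc_conic vec_arc_subset by blast
    show "triple (vector [0, 1, 0]) u v \<noteq> 0" if "u \<in> T" "v \<in> T" "u \<noteq> v" for u v
      using that st sq unfolding T_def by (auto simp: triple_expand)
  qed
  have inj: "inj_on (\<lambda>v. vec.span {v}) S"
    using st by (intro inj_on_span_singleton) (auto simp: S_def T_def vec_eq_iff forall_3)
  have "0 \<notin> S" by (auto simp: S_def T_def vec_eq_iff forall_3)
  let ?A = "(\<lambda>v. vec.span {v}) ` S"
  have "card S = 6" using st by (simp add: S_def T_def vec_eq_iff forall_3)
  then have card: "card ?A = 6" using card_image[OF inj] by simp
  obtain B where B: "complete_arc B" "?A \<subseteq> B"
    using complete_arc_extends[OF planar_arc_span[OF arc \<open>0 \<notin> S\<close>]] by blast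
  have "card B \<noteq> CARD('k) + 1"
  proof
    assume "card B = CARD('k) + 1"
    then obtain M :: "'k ^ 3 ^ 3" where M: "transpose M = M" "det M \<noteq> 0" "\<forall>P\<in>B. \<forall>x\<in>P. quad M x = 0"
      using planar_arc_segre[OF odd] B(1) unfolding complete_arc_def by metis
    have q: "quad M v = 0" if "v \<in> S" for v
      using M(3) B(2) that vec.span_base[of v "{v}"] by blast
    have sym: "M $ i $ j = M $ j $ i" for i j
      using M(1) by (simp add: vec_eq_iff transpose_def)
    define a b c where "a = M $ 1 $ 2" and "b = M $ 1 $ 3" and "c = M $ 2 $ 3"
    note two = two_neq_zero_odd_card[OF odd]
    \<comment> \<open>The three coordinate vectors belong to \<open>S\<close>, which leaves only the
      mixed terms of \<open>M\<close>.\<close>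
    have diag: "M $ 1 $ 1 = 0" "M $ 2 $ 2 = 0" "M $ 3 $ 3 = 0"
      using q[of "vector [1, 0, 0]"] q[of "vector [0, 1, 0]"] q[of "vector [0, 0, 1]"]
      by (simp_all add: S_def T_def quad_def sum_3)
    \<comment> \<open>On (1, x, x^2) the form is 2x times this polynomial. It has the three distinct
      roots 1, \<open>s\<close>, \<open>t\<close>, so all its coefficients vanish and
      \<open>M\<close> would be zero.\<close>
    have *: "a + b * x + c * (x * x) = 0" if "vector [1, x, x * x] \<in> S" "x \<noteq> 0" for x
    proof -
      have "2 * x * (a + b * x + c * (x * x)) = quad M (vector [1, x, x * x])"
        by (simp add: quad_def sum_3 diag a_def b_def c_def sym[of 2 1] sym[of 3 1] sym[of 3 2] algebra_simps)
      then show ?thesis using q[OF that(1)] that(2) two by simp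
    qed
    have 1: "a + b + c = 0" using *[of 1] by (simp add: S_def T_def)
    have 2: "a + b * s + c * (s * s) = 0" using *[of s] st by (simp add: S_def T_def)
    have 3: "a + b * t + c * (t * t) = 0" using *[of t] st by (simp add: S_def T_def)
    have "(s - 1) * (b + c * (s + 1)) = 0" using 1 2 by algebra
    then have 4: "b + c * (s + 1) = 0" using st by simp
    have "(t - 1) * (b + c * (t + 1)) = 0" using 1 3 by algebra
    then have 5: "b + c * (t + 1) = 0" using st by simp
    have "(t - s) * c = 0" using 4 5 by algebra
    then have "c = 0" using st by simp
    then have "b = 0" "a = 0" using 4 1 by auto
    then have "det M = 0" using diag \<open>c = 0\<close>
      by (simp add: det_3 a_def b_def c_def sym[of 2 1] sym[of 3 1] sym[of 3 2])
    then show False using M(2) by simp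
  qed
  moreover have "card B \<le> CARD('k) + 1" using B(1) planar_arc_card_le[OF odd] by (auto simp: complete_arc_def)
  ultimately have "card B \<le> m2' TYPE('k)"
    by (intro le_m2'[OF B(1)]) (simp add: Max_complete_arc_sizes[OF odd])
  moreover have "6 \<le> card B" using card B(2) by (metis card_mono finite)
  ultimately show ?thesis by simp
qed

section \<open>Reconstruction of the conic\<close>

text \<open>Dehomogenise by dividing by \<open>b i\<close>. At most one index has
  \<open>b i = 0\<close>, because two such pairs would be proportional; the other five or more give
  distinct roots \<open>a i / b i\<close> of a polynomial of degree at most 4.\<close>

lemma quartic_form_vanishes:
  fixes a b :: "'i \<Rightarrow> 'k::field"
  assumes F: "\<And>x y. F x y = c0 * y ^ 4 + c1 * x * y ^ 3 + c2 * x ^ 2 * y ^ 2 + c3 * x ^ 3 * y + c4 * x ^ 4"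
    and I: "finite I" "6 \<le> card I"
    and ab: "\<And>i j. i \<in> I \<Longrightarrow> j \<in> I \<Longrightarrow> i \<noteq> j \<Longrightarrow> a i * b j \<noteq> a j * b i"
    and zero: "\<And>i. i \<in> I \<Longrightarrow> F (a i) (b i) = 0"
  shows "F x y = 0"
proof -
  define J where "J = {i \<in> I. b i \<noteq> 0}"
  have "card (I - J) \<le> 1"
  proof -
    have "i = j" if "i \<in> I - J" "j \<in> I - J" for i j
      using that ab[of i j] by (auto simp: J_def)
    then show ?thesis using I(1) by (metis card_le_Suc0_iff_eq One_nat_def finite_Diff)
  qed
  moreover have "card (I - J) = card I - card J"
    using I by (intro card_Diff_subset) (auto simp: J_def)
  ultimately have J: "5 \<le> card J" using I by linarith
  define p where "p = [:c0, c1, c2, c3, c4:]"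
  have "inj_on (\<lambda>i. a i / b i) J"
  proof (rule inj_onI, rule ccontr)
    fix i j assume ij: "i \<in> J" "j \<in> J" "a i / b i = a j / b j" "i \<noteq> j"
    then have "a i * b j = a j * b i" by (simp add: J_def frac_eq_eq)
    then show False using ab[of i j] ij by (auto simp: J_def)
  qed
  then have card: "card ((\<lambda>i. a i / b i) ` J) = card J" by (rule card_image)
  have root: "poly p (a i / b i) = 0" if "i \<in> J" for i
  proof -
    have b: "b i \<noteq> 0" and i: "i \<in> I" using that by (auto simp: J_def)
    have "poly p (a i / b i) * b i ^ 4 = F (a i) (b i)"
      using b by (simp add: F p_def field_simps power4_eq_xxxx power3_eq_cube power2_eq_square)
    then show ?thesis using zero[OF i] b by simp
  qed
  have "p = 0"
  proof (rule ccontr)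
    assume "p \<noteq> 0"
    then have "card J \<le> card {x. poly p x = 0}"
      unfolding card[symmetric] using root by (intro card_mono poly_roots_finite) auto
    also have "\<dots> \<le> degree p" using \<open>p \<noteq> 0\<close> by (rule card_poly_roots_bound)
    also have "\<dots> \<le> 4" by (simp add: p_def)
    finally show False using J by simp
  qed
  then show ?thesis by (simp add: F p_def)
qed

text \<open>Divided differences. This makes the coefficients in the normal form below unique, and
  therefore linear in \<open>w\<close>.\<close>

lemma quadratic_three_roots:
  fixes A :: "'k::field"
  assumes "A + B * r + C * r ^ 2 = 0" "A + B * s + C * s ^ 2 = 0" "A + B * t + C * t ^ 2 = 0"
    and "r \<noteq> s" "r \<noteq> t" "s \<noteq> t"
  shows "A = 0 \<and> B = 0 \<and> C = 0"
proof -
  have "(r - s) * (B + C * (r + s)) = 0" using assms(1,2) by algebra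
  then have 1: "B + C * (r + s) = 0" using assms by simp
  have "(r - t) * (B + C * (r + t)) = 0" using assms(1,3) by algebra
  then have 2: "B + C * (r + t) = 0" using assms by simp
  have "(s - t) * C = 0" using 1 2 by algebra
  then have "C = 0" using assms by simp
  then show ?thesis using 1 assms(1) by simp
qed

lemma binary_proportional:
  fixes l :: "'k::field"
  assumes "l \<noteq> 0 \<or> m \<noteq> 0" "l' * m = m' * l"
  obtains s where "l' = s * l" "m' = s * m"
proof (cases "l = 0")
  case True
  then show ?thesis using assms by (intro that[of "m' / m"]) auto
next
  case False
  then show ?thesis using assms by (intro that[of "l' / l"]) (auto simp: field_simps)
qed

text \<open>The coordinate picture of the dual pseudo-arc: \<open>I\<close> indexes the elements
  other than \<open>K\<close>, with equations a x + b y = g(w). The condition \<open>ab\<close>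
  reflects triple intersections involving \<open>K\<close> (w = 0), and
  \<open>no_common_point\<close> those avoiding it. The summand 1 in \<open>card_I\<close> accounts
  for \<open>K\<close>. In the last assumption, \<open>surj \<iota>\<close> is the case of equal
  fields, where the counting arguments may lack points.\<close>

locale line_family =
  fixes \<iota> :: "'q \<Rightarrow> 'k::{field,finite}" and I :: "'i set" and a b :: "'i \<Rightarrow> 'k" and g :: "'i \<Rightarrow> 'k \<Rightarrow> 'k"
  assumes odd: "odd CARD('k)"
    and finite_I: "finite I"
    and ab: "\<And>i j. i \<in> I \<Longrightarrow> j \<in> I \<Longrightarrow> i \<noteq> j \<Longrightarrow> a i * b j \<noteq> a j * b i"
    and ab_nonzero: "\<And>i. i \<in> I \<Longrightarrow> a i \<noteq> 0 \<or> b i \<noteq> 0"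
    and g_add: "\<And>i v w. i \<in> I \<Longrightarrow> g i (v + w) = g i v + g i w"
    and g_scale: "\<And>i c w. i \<in> I \<Longrightarrow> g i (\<iota> c * w) = \<iota> c * g i w"
    and no_common_point: "\<And>i j l w x y. \<lbrakk>i \<in> I; j \<in> I; l \<in> I; i \<noteq> j; i \<noteq> l; j \<noteq> l; w \<noteq> 0;
      a i * x + b i * y = g i w; a j * x + b j * y = g j w; a l * x + b l * y = g l w\<rbrakk> \<Longrightarrow> False"
    and card_I: "m2' TYPE('k) < card I + 1"
    and surj_or_large: "surj \<iota> \<or> 7 \<le> CARD('k)"
begin

lemma g_zero: "i \<in> I \<Longrightarrow> g i 0 = 0"
  using g_add[of i 0 0] by (metis add_0 add_cancel_right_right)

lemma g_minus: "i \<in> I \<Longrightarrow> g i (- w) = - g i w"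
  using g_add[of i w "-w"] g_zero[of i] by (simp add: eq_neg_iff_add_eq_0 add.commute)

text \<open>For fixed \<open>w\<close>, the lines a x + b y = g(w) of an affine plane together with
  its line at infinity (0, 0, 1), read as points of the dual plane.\<close>

definition vecs :: "'k \<Rightarrow> ('k ^ 3) set" where
  "vecs w = insert (vector [0, 0, 1]) ((\<lambda>i. vector [a i, b i, - g i w]) ` I)"

lemma vec_arc_vecs:
  assumes w: "w \<noteq> 0"
  shows "vec_arc (vecs w)"
  unfolding vecs_def
proof (rule vec_arc_insert)
  let ?v = "\<lambda>i. vector [a i, b i, - g i w] :: 'k ^ 3"
  show "triple (vector [0, 0, 1]) u v \<noteq> 0" if "u \<in> ?v ` I" "v \<in> ?v ` I" "u \<noteq> v" for u v
  proof -
    obtain i j where ij: "i \<in> I" "j \<in> I" "i \<noteq> j" "u = ?v i" "v = ?v j" using \<open>u \<in> _\<close> \<open>v \<in> _\<close> \<open>u \<noteq> v\<close> by blast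
    then show ?thesis using ab[of i j] by (simp add: triple_expand mult.commute)
  qed
  show "vec_arc (?v ` I)" unfolding vec_arc_def
  proof (intro ballI impI notI)
    fix u v z assume "u \<in> ?v ` I" "v \<in> ?v ` I" "z \<in> ?v ` I" "u \<noteq> v \<and> u \<noteq> z \<and> v \<noteq> z"
    then obtain i j l where ijl: "i \<in> I" "j \<in> I" "l \<in> I" "i \<noteq> j" "i \<noteq> l" "j \<noteq> l"
      and uvz: "u = ?v i" "v = ?v j" "z = ?v l" by blast
    assume "triple u v z = 0"
    then obtain c where c: "c \<noteq> 0" "dot c u = 0" "dot c v = 0" "dot c z = 0"
      unfolding triple_eq_0_iff by blast
    show False
    \<comment> \<open>Dually, \<open>c\<close> is a common point of three lines: at infinity if its
      third coordinate vanishes, otherwise the affine point obtained by dividing by that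
      coordinate.\<close>
    proof (cases "c $ 3 = 0")
      case True
      then have "c $ 1 * a i + c $ 2 * b i = 0" "c $ 1 * a j + c $ 2 * b j = 0"
        using c by (simp_all add: uvz dot_3)
      then have "c $ 1 * (a i * b j - a j * b i) = 0" "c $ 2 * (a i * b j - a j * b i) = 0"
        by algebra+
      then have "c $ 1 = 0" "c $ 2 = 0" using ab[of i j] ijl by auto
      then show False using True c(1) by (simp add: vec_eq_iff forall_3)
    next
      case False
      have "a m * (c $ 1 / c $ 3) + b m * (c $ 2 / c $ 3) = g m w" if "dot c (?v m) = 0" for m
        using that False by (simp add: dot_3 field_simps)
      then show False using no_common_point[OF ijl w] c uvz by metis
    qed
  qed
qed

lemma inj_on_span_vecs: "inj_on (\<lambda>v. vec.span {v}) (vecs w)"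
proof (rule inj_on_span_singleton)
  fix u v c assume "u \<in> vecs w" "v \<in> vecs w" and uv: "u = c *s v"
  then consider "u = vector [0, 0, 1]" "v = vector [0, 0, 1]"
    | i where "i \<in> I" "u = vector [0, 0, 1]" "v = vector [a i, b i, - g i w]"
    | i where "i \<in> I" "v = vector [0, 0, 1]" "u = vector [a i, b i, - g i w]"
    | i j where "i \<in> I" "j \<in> I" "u = vector [a i, b i, - g i w]" "v = vector [a j, b j, - g j w]"
    by (auto simp: vecs_def)
  then show "u = v"
  proof cases
    case (2 i)
    then show ?thesis using uv ab_nonzero[of i] by (auto simp: vec_eq_iff forall_3)
  next
    case (3 i)
    then show ?thesis using uv ab_nonzero[of i] by (auto simp: vec_eq_iff forall_3)
  next
    case (4 i j)
    then have "a i = c * a j" "b i = c * b j" using uv by (simp_all add: vec_eq_iff forall_3)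
    then have "a i * b j = a j * b i" by simp
    then show ?thesis using ab[of i j] 4 by blast
  qed simp
qed

lemma card_vecs: "card (vecs w) = card I + 1"
proof -
  have "inj_on (\<lambda>i. vector [a i, b i, - g i w] :: 'k ^ 3) I"
  proof (rule inj_onI, rule ccontr)
    fix i j assume "i \<in> I" "j \<in> I" "(vector [a i, b i, - g i w] :: 'k ^ 3) = vector [a j, b j, - g j w]" "i \<noteq> j"
    then show False using ab[of i j] by (simp add: vec_eq_iff forall_3)
  qed
  then have "card ((\<lambda>i. vector [a i, b i, - g i w] :: 'k ^ 3) ` I) = card I" by (rule card_image)
  moreover have "vector [0, 0, 1] \<notin> (\<lambda>i. vector [a i, b i, - g i w] :: 'k ^ 3) ` I"
    using ab_nonzero by (auto simp: vec_eq_iff forall_3)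
  ultimately show ?thesis unfolding vecs_def using finite_I by simp
qed

text \<open>With L = l x + m y and Q = \<alpha> x^2 + \<beta> x y + \<gamma> y^2 the first part is g
  = Q / L without denominators. The second part is Q at the zero (m, -l) of L; it expresses that the
  conic is nondegenerate and also forces L to be nonzero.\<close>

definition on_conic :: "'k \<Rightarrow> 'k \<Rightarrow> 'k \<Rightarrow> 'k \<Rightarrow> 'k \<Rightarrow> 'k \<Rightarrow> bool" where
  "on_conic w l m \<alpha> \<beta> \<gamma> \<longleftrightarrow>
     (\<forall>i\<in>I. g i w * (l * a i + m * b i) = \<alpha> * a i ^ 2 + \<beta> * a i * b i + \<gamma> * b i ^ 2) \<and>
     \<alpha> * m ^ 2 - \<beta> * m * l + \<gamma> * l ^ 2 \<noteq> 0"

text \<open>The conic through the arc \<open>vecs w\<close> contains (0, 0, 1), so its matrix has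
  \<open>M $ 3 $ 3 = 0\<close> and its equation is linear in \<open>g i w\<close>. The nondegeneracy
  term is -4 times the determinant of the matrix.\<close>

lemma on_conic_exists:
  assumes w: "w \<noteq> 0"
  shows "\<exists>l m \<alpha> \<beta> \<gamma>. on_conic w l m \<alpha> \<beta> \<gamma>"
proof -
  let ?A = "(\<lambda>v. vec.span {v}) ` vecs w"
  have "0 \<notin> vecs w" using ab_nonzero by (auto simp: vecs_def vec_eq_iff forall_3)
  then have "planar_arc ?A" using vec_arc_vecs[OF w] planar_arc_span by blast
  moreover have "m2' TYPE('k) < card ?A"
    using card_image[OF inj_on_span_vecs] card_vecs card_I by simp
  ultimately obtain M :: "'k ^ 3 ^ 3" where M: "transpose M = M" "det M \<noteq> 0" "\<forall>P\<in>?A. \<forall>x\<in>P. quad M x = 0"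
    using large_arc_on_conic[OF odd] by blast
  have q: "quad M v = 0" if "v \<in> vecs w" for v
    using M(3) that vec.span_base[of v "{v}"] by blast
  have sym: "M $ 2 $ 1 = M $ 1 $ 2" "M $ 3 $ 1 = M $ 1 $ 3" "M $ 3 $ 2 = M $ 2 $ 3"
    using M(1) by (auto simp: vec_eq_iff transpose_def)
  have M33: "M $ 3 $ 3 = 0"
    using q[of "vector [0, 0, 1]"] by (simp add: vecs_def quad_def sum_3)
  have "g i w * (2 * M $ 1 $ 3 * a i + 2 * M $ 2 $ 3 * b i)
      = M $ 1 $ 1 * a i ^ 2 + 2 * M $ 1 $ 2 * a i * b i + M $ 2 $ 2 * b i ^ 2" if "i \<in> I" for i
  proof -
    have "quad M (vector [a i, b i, - g i w]) = 0" using that by (intro q) (auto simp: vecs_def)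
    then show ?thesis by (simp add: quad_def sum_3 M33 sym power2_eq_square algebra_simps)
  qed
  moreover have "M $ 1 $ 1 * (2 * M $ 2 $ 3) ^ 2 - 2 * M $ 1 $ 2 * (2 * M $ 2 $ 3) * (2 * M $ 1 $ 3)
      + M $ 2 $ 2 * (2 * M $ 1 $ 3) ^ 2 = - (2 * (2 * det M))"
    by (simp add: det_3 M33 sym power2_eq_square algebra_simps)
  then have "M $ 1 $ 1 * (2 * M $ 2 $ 3) ^ 2 - 2 * M $ 1 $ 2 * (2 * M $ 2 $ 3) * (2 * M $ 1 $ 3)
      + M $ 2 $ 2 * (2 * M $ 1 $ 3) ^ 2 \<noteq> 0"
    using M(2) two_neq_zero_odd_card[OF odd] by (metis mult_eq_0_iff neg_equal_0_iff_equal)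
  ultimately show ?thesis unfolding on_conic_def by blast
qed

text \<open>Additivity of \<open>g i\<close> says Q''/L'' = Q/L + Q'/L' at every (a, b). Cleared of
  denominators this is a quartic form with too many zeros, hence an identity. If L and L' had
  different zeros, L'' would vanish at both, so L'' = 0, against nondegeneracy of the third
  conic.\<close>

lemma on_conic_sum_proportional:
  assumes I6: "6 \<le> card I"
    and c: "on_conic v l m \<alpha> \<beta> \<gamma>" and c': "on_conic w l' m' \<alpha>' \<beta>' \<gamma>'"
    and c'': "on_conic (v + w) l'' m'' \<alpha>'' \<beta>'' \<gamma>''"
  shows "l' * m = m' * l"
proof -
  define Q where "Q x y = \<alpha> * x ^ 2 + \<beta> * x * y + \<gamma> * y ^ 2" for x y
  define Q' where "Q' x y = \<alpha>' * x ^ 2 + \<beta>' * x * y + \<gamma>' * y ^ 2" for x y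
  define Q'' where "Q'' x y = \<alpha>'' * x ^ 2 + \<beta>'' * x * y + \<gamma>'' * y ^ 2" for x y
  define L where "L x y = l * x + m * y" for x y
  define L' where "L' x y = l' * x + m' * y" for x y
  define L'' where "L'' x y = l'' * x + m'' * y" for x y
  define F where "F x y = Q'' x y * L x y * L' x y - L'' x y * (Q x y * L' x y + Q' x y * L x y)" for x y
  have F: "F x y = (\<gamma>'' * m * m' - m'' * (\<gamma> * m' + \<gamma>' * m)) * y ^ 4
    + (\<beta>'' * m * m' + \<gamma>'' * (l * m' + m * l') - l'' * (\<gamma> * m' + \<gamma>' * m)
        - m'' * (\<beta> * m' + \<gamma> * l' + \<beta>' * m + \<gamma>' * l)) * x * y ^ 3
    + (\<alpha>'' * m * m' + \<beta>'' * (l * m' + m * l') + \<gamma>'' * l * l'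
        - l'' * (\<beta> * m' + \<gamma> * l' + \<beta>' * m + \<gamma>' * l) - m'' * (\<alpha> * m' + \<beta> * l' + \<alpha>' * m + \<beta>' * l)) * x ^ 2 * y ^ 2
    + (\<alpha>'' * (l * m' + m * l') + \<beta>'' * l * l' - l'' * (\<alpha> * m' + \<beta> * l' + \<alpha>' * m + \<beta>' * l)
        - m'' * (\<alpha> * l' + \<alpha>' * l)) * x ^ 3 * y
    + (\<alpha>'' * l * l' - l'' * (\<alpha> * l' + \<alpha>' * l)) * x ^ 4" for x y
    unfolding F_def Q_def Q'_def Q''_def L_def L'_def L''_def by algebra
  have "F (a i) (b i) = 0" if i: "i \<in> I" for i
  proof -
    have "Q (a i) (b i) = g i v * L (a i) (b i)" "Q' (a i) (b i) = g i w * L' (a i) (b i)"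
      "Q'' (a i) (b i) = (g i v + g i w) * L'' (a i) (b i)"
      using c c' c'' i
      by (simp_all add: on_conic_def Q_def Q'_def Q''_def L_def L'_def L''_def g_add)
    then show ?thesis unfolding F_def by algebra
  qed
  note F_zero = this
  have F0: "F x y = 0" for x y
    by (rule quartic_form_vanishes[where a = a and b = b and I = I and F = F, OF F finite_I I6])
      (fact ab F_zero)+
  have Qp: "Q m (- l) \<noteq> 0" "Q' m' (- l') \<noteq> 0" "Q'' m'' (- l'') \<noteq> 0"
    using c c' c'' by (simp_all add: on_conic_def Q_def Q'_def Q''_def algebra_simps)
  have Lp: "L m (- l) = 0" "L' m' (- l') = 0" by (simp_all add: L_def L'_def)
  \<comment> \<open>At the zero of L only the term with Q survives, and Q is nonzero there; below,
    the same happens at the zero of L'.\<close>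
  have "L'' m (- l) * (Q m (- l) * L' m (- l)) = 0" using F0[of m "- l"] Lp by (simp add: F_def)
  then have 1: "L'' m (- l) = 0 \<or> L' m (- l) = 0" using Qp by simp
  have "L'' m' (- l') * (Q' m' (- l') * L m' (- l')) = 0" using F0[of m' "- l'"] Lp by (simp add: F_def)
  then have 2: "L'' m' (- l') = 0 \<or> L m' (- l') = 0" using Qp by simp
  show ?thesis
  proof (rule ccontr)
    assume ne: "l' * m \<noteq> m' * l"
    then have "l'' * m - m'' * l = 0" "l'' * m' - m'' * l' = 0"
      using 1 2 by (auto simp: L_def L'_def L''_def algebra_simps)
    then have "l'' * (l' * m - m' * l) = 0" "m'' * (l' * m - m' * l) = 0" by algebra+
    then have "l'' = 0" "m'' = 0" using ne by auto
    then show False using Qp(3) by (simp add: Q''_def)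
  qed
qed

lemma on_conic_scale:
  assumes "on_conic w (s * l) (s * m) \<alpha> \<beta> \<gamma>"
  shows "on_conic w l m (\<alpha> / s) (\<beta> / s) (\<gamma> / s)"
proof -
  have s: "s \<noteq> 0" using assms by (auto simp: on_conic_def)
  have "g i w * (l * a i + m * b i) = \<alpha> / s * a i ^ 2 + \<beta> / s * a i * b i + \<gamma> / s * b i ^ 2" if "i \<in> I" for i
    using assms that s unfolding on_conic_def by (simp add: field_simps)
  moreover have "\<alpha> * (s * m) ^ 2 - \<beta> * (s * m) * (s * l) + \<gamma> * (s * l) ^ 2
      = s ^ 3 * (\<alpha> / s * m ^ 2 - \<beta> / s * m * l + \<gamma> / s * l ^ 2)"
    using s by (simp add: field_simps power2_eq_square power3_eq_cube)
  ultimately show ?thesis using assms s unfolding on_conic_def by simp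
qed

text \<open>Every tangent form is compared with the one for \<open>w = 1\<close>, via the conic of
  the sum \<open>1 + w\<close>, and then rescaled to it.\<close>

lemma common_tangent:
  shows "\<exists>l m. \<forall>w. w \<noteq> 0 \<longrightarrow> (\<exists>\<alpha> \<beta> \<gamma>. on_conic w l m \<alpha> \<beta> \<gamma>)"
proof -
  obtain l m \<alpha> \<beta> \<gamma> where c: "on_conic 1 l m \<alpha> \<beta> \<gamma>" using on_conic_exists[of 1] by auto
  have "\<exists>\<alpha> \<beta> \<gamma>. on_conic w l m \<alpha> \<beta> \<gamma>" if w: "w \<noteq> 0" for w
  proof (cases "surj \<iota>")
    case True
    then obtain d where d: "w = \<iota> d" by blast
    \<comment> \<open>If the two fields coincide, \<open>g i\<close> is linear over the big field
      and the conic for 1 can simply be scaled.\<close>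
    have "g i w = w * g i 1" if "i \<in> I" for i using g_scale[OF that, of d 1] by (simp add: d)
    then have "on_conic w l m (w * \<alpha>) (w * \<beta>) (w * \<gamma>)"
      using c w unfolding on_conic_def by (simp add: algebra_simps)
        (simp flip: distrib_left right_diff_distrib add: mult.left_commute[of _ w] mult.assoc)
    then show ?thesis by blast
  next
    case False
    then have "7 \<le> CARD('k)" using surj_or_large by blast
    then have I6: "6 \<le> card I" using six_le_m2'[OF odd] card_I by linarith
    show ?thesis
    \<comment> \<open>For \<open>w = -1\<close> the sum \<open>1 + w\<close> is 0 and has no conic;
      here negating the conic for 1 suffices.\<close>
    proof (cases "w = -1")
      case True
      have "(- \<alpha>) * m ^ 2 - (- \<beta>) * m * l + (- \<gamma>) * l ^ 2 = - (\<alpha> * m ^ 2 - \<beta> * m * l + \<gamma> * l ^ 2)"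
        by algebra
      then have "(- \<alpha>) * m ^ 2 - (- \<beta>) * m * l + (- \<gamma>) * l ^ 2 \<noteq> 0"
        using c unfolding on_conic_def by (metis neg_equal_0_iff_equal)
      then have "on_conic w l m (- \<alpha>) (- \<beta>) (- \<gamma>)"
        using c True unfolding on_conic_def by (simp add: g_minus)
      then show ?thesis by blast
    next
      case False
      obtain l' m' \<alpha>' \<beta>' \<gamma>' where c': "on_conic w l' m' \<alpha>' \<beta>' \<gamma>'" using on_conic_exists[OF w] by auto
      have "1 + w \<noteq> 0" using False by (metis add.commute eq_neg_iff_add_eq_0)
      then obtain l'' m'' \<alpha>'' \<beta>'' \<gamma>'' where c'': "on_conic (1 + w) l'' m'' \<alpha>'' \<beta>'' \<gamma>''"
        using on_conic_exists by blast
      have "l \<noteq> 0 \<or> m \<noteq> 0" using c by (auto simp: on_conic_def)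
      moreover have "l' * m = m' * l" using on_conic_sum_proportional[OF I6 c c' c''] .
      ultimately obtain s where "l' = s * l" "m' = s * m" by (rule binary_proportional)
      then show ?thesis using on_conic_scale c' by blast
    qed
  qed
  then show ?thesis by blast
qed

definition \<iota>_linear :: "('k \<Rightarrow> 'k) \<Rightarrow> bool" where
  "\<iota>_linear f \<longleftrightarrow> (\<forall>v w. f (v + w) = f v + f w) \<and> (\<forall>c w. f (\<iota> c * w) = \<iota> c * f w)"

text \<open>Take u with L(u) = 1 and v = (m, -l) spanning the kernel of the common tangent form L.
  Then (a, b) = \<rho> (u + t v) with \<rho> = L(a, b), and g = Q/L becomes \<rho> times a quadratic
  polynomial in t whose leading coefficient Q(v) is nonzero.\<close>

lemma normal_form:
  obtains u1 u2 v1 v2 \<rho> t A B C where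
    "u1 * v2 - u2 * v1 \<noteq> (0::'k)"
    "\<And>i. i \<in> I \<Longrightarrow> \<rho> i \<noteq> 0 \<and> a i = \<rho> i * (u1 + t i * v1) \<and> b i = \<rho> i * (u2 + t i * v2)"
    "\<And>i w. i \<in> I \<Longrightarrow> g i w = \<rho> i * (A w + B w * t i + C w * t i ^ 2)"
    "\<iota>_linear A" "\<iota>_linear B" "\<iota>_linear C" "\<And>w. w \<noteq> 0 \<Longrightarrow> C w \<noteq> 0"
proof -
  obtain l m where lm: "\<And>w. w \<noteq> 0 \<Longrightarrow> \<exists>\<alpha> \<beta> \<gamma>. on_conic w l m \<alpha> \<beta> \<gamma>" using common_tangent by metis
  obtain \<alpha> \<beta> \<gamma> where c1: "on_conic 1 l m \<alpha> \<beta> \<gamma>" using lm[of 1] by auto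
  then have lm0: "l \<noteq> 0 \<or> m \<noteq> 0" by (auto simp: on_conic_def)
  obtain u1 u2 where u: "l * u1 + m * u2 = 1"
  proof (cases "l = 0")
    case True
    then show ?thesis using lm0 that[of 0 "1 / m"] by simp
  next
    case False
    then show ?thesis using that[of "1 / l" 0] by simp
  qed
  define \<rho> where "\<rho> i = l * a i + m * b i" for i
  define t where "t i = - (u1 * b i - u2 * a i) / \<rho> i" for i
  \<comment> \<open>If L vanishes at (a, b), then so does Q by the conic equation; but (a, b) is
    then a nonzero multiple of (m, -l), where Q does not vanish.\<close>
  have \<rho>: "\<rho> i \<noteq> 0" if i: "i \<in> I" for i
  proof
    assume "\<rho> i = 0"
    then have "a i * l = - b i * m" by (simp add: \<rho>_def eq_neg_iff_add_eq_0 mult.commute)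
    then obtain s where s: "a i = s * m" "- b i = s * l"
      using lm0 by (elim binary_proportional[of m l "a i" "- b i", rotated]) auto
    then have b: "b i = - (s * l)" by (metis minus_minus)
    have "s \<noteq> 0" using s b ab_nonzero[OF i] by auto
    have "\<alpha> * a i ^ 2 + \<beta> * a i * b i + \<gamma> * b i ^ 2 = 0"
      using c1 i \<open>\<rho> i = 0\<close> unfolding on_conic_def \<rho>_def by (metis mult_zero_right)
    then have "s ^ 2 * (\<alpha> * m ^ 2 - \<beta> * m * l + \<gamma> * l ^ 2) = 0"
      unfolding s(1) b by algebra
    then show False using c1 \<open>s \<noteq> 0\<close> by (simp add: on_conic_def)
  qed
  have abt: "a i = \<rho> i * (u1 + t i * m)" "b i = \<rho> i * (u2 + t i * (- l))" if i: "i \<in> I" for i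
  proof -
    have t: "t i * \<rho> i = - (u1 * b i - u2 * a i)" using \<rho>[OF i] by (simp add: t_def)
    show "a i = \<rho> i * (u1 + t i * m)" "b i = \<rho> i * (u2 + t i * (- l))"
      using t u \<rho>_def[of i] by algebra+
  qed
  have inj_t: "t i \<noteq> t j" if "i \<in> I" "j \<in> I" "i \<noteq> j" for i j
    using ab[OF that] abt that by auto
  have "\<exists>A B C. (\<forall>i\<in>I. g i w = \<rho> i * (A + B * t i + C * t i ^ 2)) \<and> (w \<noteq> 0 \<longrightarrow> C \<noteq> 0)" for w
  proof (cases "w = 0")
    case True
    then show ?thesis using g_zero by (intro exI[of _ 0]) simp
  next
    case False
    then obtain \<alpha> \<beta> \<gamma> where c: "on_conic w l m \<alpha> \<beta> \<gamma>" using lm by blast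
    \<comment> \<open>\<open>A\<close>, \<open>B\<close>, \<open>C\<close> are the coefficients of
      Q(u + t v) as a polynomial in t.\<close>
    define A where "A = \<alpha> * u1 ^ 2 + \<beta> * u1 * u2 + \<gamma> * u2 ^ 2"
    define B where "B = 2 * \<alpha> * u1 * m + \<beta> * (u2 * m - u1 * l) - 2 * \<gamma> * u2 * l"
    define C where "C = \<alpha> * m ^ 2 - \<beta> * m * l + \<gamma> * l ^ 2"
    have "g i w = \<rho> i * (A + B * t i + C * t i ^ 2)" if i: "i \<in> I" for i
    proof -
      have "g i w * \<rho> i = \<alpha> * a i ^ 2 + \<beta> * a i * b i + \<gamma> * b i ^ 2"
        using c i by (simp add: on_conic_def \<rho>_def)
      also have "\<dots> = \<rho> i * (A + B * t i + C * t i ^ 2) * \<rho> i"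
        unfolding A_def B_def C_def abt[OF i] by algebra
      finally show ?thesis using \<rho>[OF i] by simp
    qed
    moreover have "C \<noteq> 0" using c by (simp add: on_conic_def C_def)
    ultimately show ?thesis by blast
  qed
  then obtain A B C where ABC: "\<And>i w. i \<in> I \<Longrightarrow> g i w = \<rho> i * (A w + B w * t i + C w * t i ^ 2)"
    "\<And>w. w \<noteq> 0 \<Longrightarrow> C w \<noteq> 0" by metis
  have det: "u1 * (- l) - u2 * m \<noteq> 0" using u by (metis add.inverse_inverse diff_minus_eq_add
        minus_diff_eq mult.commute mult_minus_right neg_0_equal_iff_equal zero_neq_one add.commute)
  show thesis
  \<comment> \<open>Over equal fields \<open>I\<close> may have fewer than three elements, so the
    chosen \<open>A\<close>, \<open>B\<close>, \<open>C\<close> need not be unique. They are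
    replaced by multiples of their values at 1.\<close>
  proof (cases "surj \<iota>")
    case True
    have g1: "g i w = w * g i 1" if "i \<in> I" for i w
      using g_scale[OF that, of _ 1] True by (metis mult.right_neutral surj_def)
    show thesis
    \<comment> \<open>The positions follow the first occurrences in the statement, that is
      \<open>u1\<close>, \<open>v2\<close>, \<open>u2\<close>, \<open>v1\<close>; so v = (m, -l),
      and the determinant is -1.\<close>
    proof (rule that[of u1 "- l" u2 m \<rho> t "\<lambda>w. w * A 1" "\<lambda>w. w * B 1" "\<lambda>w. w * C 1"])
      show "g i w = \<rho> i * (w * A 1 + w * B 1 * t i + w * C 1 * t i ^ 2)" if "i \<in> I" for i w
        unfolding g1[OF that, of w] ABC(1)[OF that, of 1] by (simp add: algebra_simps)
    qed (use det abt \<rho> ABC in \<open>auto simp: \<iota>_linear_def algebra_simps\<close>)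
  next
    case False
    then have "7 \<le> CARD('k)" using surj_or_large by blast
    then have "3 \<le> card I" using six_le_m2'[OF odd] card_I by linarith
    then obtain i j k where ijk: "i \<in> I" "j \<in> I" "k \<in> I" "i \<noteq> j" "i \<noteq> k" "j \<noteq> k" by (rule card_ge_3E)
    \<comment> \<open>Three distinct parameters determine the coefficients, so linearity of each
      \<open>g i\<close> passes to \<open>A\<close>, \<open>B\<close> and \<open>C\<close>.\<close>
    have uniq: "X = 0 \<and> Y = 0 \<and> Z = 0" if "\<And>i. i \<in> I \<Longrightarrow> X + Y * t i + Z * t i ^ 2 = 0" for X Y Z
      using that ijk inj_t by (intro quadratic_three_roots[of X Y "t i" Z "t j" "t k"]) auto
    have add: "A (v + w) - (A v + A w) = 0 \<and> B (v + w) - (B v + B w) = 0 \<and> C (v + w) - (C v + C w) = 0" for v w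
    proof (rule uniq)
      fix i assume i: "i \<in> I"
      have "\<rho> i * (A (v + w) + B (v + w) * t i + C (v + w) * t i ^ 2)
        = \<rho> i * (A v + B v * t i + C v * t i ^ 2) + \<rho> i * (A w + B w * t i + C w * t i ^ 2)"
        using g_add[OF i] unfolding ABC(1)[OF i] .
      then have "\<rho> i * (A (v + w) - (A v + A w) + (B (v + w) - (B v + B w)) * t i + (C (v + w) - (C v + C w)) * t i ^ 2) = 0"
        by algebra
      then show "A (v + w) - (A v + A w) + (B (v + w) - (B v + B w)) * t i + (C (v + w) - (C v + C w)) * t i ^ 2 = 0"
        using \<rho>[OF i] by simp
    qed
    have scale: "A (\<iota> d * w) - \<iota> d * A w = 0 \<and> B (\<iota> d * w) - \<iota> d * B w = 0 \<and> C (\<iota> d * w) - \<iota> d * C w = 0" for d w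
    proof (rule uniq)
      fix i assume i: "i \<in> I"
      have "\<rho> i * (A (\<iota> d * w) + B (\<iota> d * w) * t i + C (\<iota> d * w) * t i ^ 2)
        = \<iota> d * (\<rho> i * (A w + B w * t i + C w * t i ^ 2))"
        using g_scale[OF i] unfolding ABC(1)[OF i] .
      then have "\<rho> i * (A (\<iota> d * w) - \<iota> d * A w + (B (\<iota> d * w) - \<iota> d * B w) * t i + (C (\<iota> d * w) - \<iota> d * C w) * t i ^ 2) = 0"
        by algebra
      then show "A (\<iota> d * w) - \<iota> d * A w + (B (\<iota> d * w) - \<iota> d * B w) * t i + (C (\<iota> d * w) - \<iota> d * C w) * t i ^ 2 = 0"
        using \<rho>[OF i] by simp
    qed
    show thesis
      by (rule that[of u1 "- l" u2 m \<rho> t A B C])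
        (use det abt \<rho> ABC add scale in \<open>auto simp: \<iota>_linear_def\<close>)
  qed
qed

end

section \<open>Field reduction and duality\<close>

text \<open>Adjoining \<open>b\<close> multiplies the size by the number of scalars. The abstract
  setting also covers the big coordinate space with scalars restricted to the small field.\<close>

lemma (in vector_space) card_span_independent:
  assumes "finite (UNIV :: 'a set)" "finite B" "independent B"
  shows "finite (span B) \<and> card (span B) = CARD('a) ^ card B"
  using assms(2,3)
proof (induction B rule: finite_induct)
  case (insert b B)
  then have B: "b \<notin> span B" "independent B" by (auto simp: independent_insert)
  let ?f = "\<lambda>(c, x). c *s b + x"
  have "inj_on ?f (UNIV \<times> span B)"
  proof (rule inj_onI, clarify)
    fix c d x y assume x: "x \<in> span B" and y: "y \<in> span B" and eq: "c *s b + x = d *s b + y"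
    have *: "(c - d) *s b = y - x" using eq by (simp add: scale_left_diff_distrib algebra_simps)
    have "c = d"
    proof (rule ccontr)
      assume "c \<noteq> d"
      then have "b = inverse (c - d) *s (y - x)" unfolding *[symmetric] by simp
      then show False using B x y span_scale span_diff by metis
    qed
    then show "c = d \<and> x = y" using eq by simp
  qed
  moreover have "span (insert b B) = ?f ` (UNIV \<times> span B)"
  proof
    show "span (insert b B) \<subseteq> ?f ` (UNIV \<times> span B)"
    proof
      fix x assume "x \<in> span (insert b B)"
      then obtain c where "x - c *s b \<in> span B" unfolding span_insert by auto
      then show "x \<in> ?f ` (UNIV \<times> span B)" by (intro image_eqI[of _ _ "(c, x - c *s b)"]) auto
    qed
    show "?f ` (UNIV \<times> span B) \<subseteq> span (insert b B)"
    proof clarify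
      fix c x assume "x \<in> span B"
      then have "c *s b + x - c *s b \<in> span B" by simp
      then show "c *s b + x \<in> span (insert b B)" unfolding span_insert by blast
    qed
  qed
  ultimately show ?case using insert B assms(1) by (simp add: card_image card_cartesian_product)
qed (simp add: span_empty)

lemma card_subspace:
  fixes U :: "('q::{field,finite} ^ 'm) set"
  assumes "vec.subspace U"
  shows "card U = CARD('q) ^ vec.dim U"
proof -
  obtain B where B: "B \<subseteq> U" "vec.independent B" "U \<subseteq> vec.span B" "card B = vec.dim U"
    by (rule vec.basis_exists[of U])
  then have "vec.span B = U" using assms by (metis vec.span_minimal subset_antisym)
  then show ?thesis using vec.card_span_independent[of B] B by simp
qed

text \<open>A basis of \<open>S\<close> and its image extend to bases of the two spaces, and the
  remaining basis vectors are matched by any bijection.\<close>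

lemma (in vector_space_pair) extend_injective_linear:
  assumes fin: "finite (UNIV :: 'a set)" "finite (UNIV :: 'b set)" "finite (UNIV :: 'c set)"
    and card: "CARD('b) = CARD('c)"
    and f: "Vector_Spaces.linear s1 s2 f" and S: "vs1.subspace S" and inj: "inj_on f S"
  obtains h where "Vector_Spaces.linear s1 s2 h" "bij h" "\<And>x. x \<in> S \<Longrightarrow> h x = f x"
proof -
  interpret f: Vector_Spaces.linear s1 s2 f by fact
  obtain B where B: "B \<subseteq> S" "vs1.independent B" "S \<subseteq> vs1.span B"
    by (rule vs1.basis_exists[of S])
  have spanB: "vs1.span B = S" using B S by (metis vs1.span_minimal subset_antisym)
  have fB: "vs2.independent (f ` B)"
    using linear_independent_injective_image[OF f] B(2) inj spanB by simp
  define X where "X = vs1.extend_basis B"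
  define Y where "Y = vs2.extend_basis (f ` B)"
  have X: "B \<subseteq> X" "vs1.independent X" "vs1.span X = UNIV"
    unfolding X_def using B(2) by (auto simp: vs1.extend_basis_superset vs1.independent_extend_basis)
  have Y: "f ` B \<subseteq> Y" "vs2.independent Y" "vs2.span Y = UNIV"
    unfolding Y_def using fB by (auto simp: vs2.extend_basis_superset vs2.independent_extend_basis)
  have finX: "finite X" and finY: "finite Y"
    using fin(2,3) by (meson finite_subset subset_UNIV)+
  \<comment> \<open>Equal cardinality of the spaces stands in for equal dimension.\<close>
  have "CARD('a) ^ card X = CARD('a) ^ card Y"
    using vs1.card_span_independent[OF fin(1) finX X(2)] vs2.card_span_independent[OF fin(1) finY Y(2)]
      X(3) Y(3) card by simp
  moreover have "card {0, 1 :: 'a} \<le> CARD('a)" by (rule card_mono) (use fin in auto)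
  then have "1 < CARD('a)" by simp
  ultimately have cardXY: "card X = card Y" by (simp add: power_inject_exp)
  have cardB: "card (f ` B) = card B" using inj B(1) by (meson card_image inj_on_subset)
  have "card (X - B) = card (Y - f ` B)"
    using cardXY cardB X(1) Y(1) finX finY by (simp add: card_Diff_subset finite_subset)
  then obtain e where e: "bij_betw e (X - B) (Y - f ` B)"
    using finite_same_card_bij finX finY by (metis finite_Diff)
  define g where "g b = (if b \<in> B then f b else e b)" for b
  define h where "h = construct X g"
  have h: "Vector_Spaces.linear s1 s2 h" unfolding h_def by (rule linear_construct[OF X(2)])
  have hb: "h b = g b" if "b \<in> X" for b unfolding h_def using construct_basis[OF X(2) that] .
  have "h ` X = Y"
  proof -
    have "h ` X = g ` X" using hb by auto
    also have "\<dots> = g ` B \<union> g ` (X - B)" using X(1) by blast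
    also have "g ` B = f ` B" by (auto simp: g_def)
    also have "g ` (X - B) = e ` (X - B)" by (auto simp: g_def)
    also have "\<dots> = Y - f ` B" using e by (simp add: bij_betw_def)
    finally show ?thesis using Y(1) by blast
  qed
  then have surj: "range h = UNIV"
    using linear_span_image[OF h, of X] X(3) Y(3) by simp
  then have "inj h" using card fin(2) by (intro eq_card_imp_inj_on) auto
  then have "bij h" using surj by (simp add: bij_def)
  moreover have "h b = f b" if "b \<in> B" for b using that hb X(1) by (auto simp: g_def)
  then have "h x = f x" if "x \<in> S" for x
    using linear_eq_on[OF h f, of x B] that spanB by blast
  ultimately show thesis using that h by blast
qed

section \<open>Field reduction in coordinates\<close>

lemma vector_space_restrict_scalars:
  assumes "field_embedding \<iota>"
  shows "vector_space (\<lambda>c (x :: 'k::field ^ 'd). \<iota> c *s x)"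
  using assms by (auto simp: vector_space_def field_embedding_def vector_add_ldistrib vector_sadd_rdistrib)

lemma vec_3_eqI: "u $ 1 = v $ 1 \<Longrightarrow> u $ 2 = v $ 2 \<Longrightarrow> u $ 3 = v $ 3 \<Longrightarrow> u = (v :: 'a ^ 3)"
  by (simp add: vec_eq_iff forall_3)

lemma vec_2_eqI: "u $ 1 = v $ 1 \<Longrightarrow> u $ 2 = v $ 2 \<Longrightarrow> u = (v :: 'a ^ 2)"
  by (simp add: vec_eq_iff forall_2)

lemma field_reductionD:
  assumes "field_reduction \<iota> \<phi> W"
  shows "\<phi> (x + y) = \<phi> x + \<phi> y" "\<phi> (\<iota> c *s x) = c *s \<phi> x" "\<phi> x = \<phi> y \<longleftrightarrow> x = y" "\<phi> 0 = 0" "\<phi> (x - y) = \<phi> x - \<phi> y"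
proof -
  show add: "\<phi> (x + y) = \<phi> x + \<phi> y" for x y
    using assms by (simp add: field_reduction_def Vector_Spaces.linear_iff)
  show "\<phi> (\<iota> c *s x) = c *s \<phi> x" "\<phi> x = \<phi> y \<longleftrightarrow> x = y"
    using assms by (auto simp: field_reduction_def Vector_Spaces.linear_iff inj_eq)
  show "\<phi> 0 = 0" using add[of 0 0] by simp
  show "\<phi> (x - y) = \<phi> x - \<phi> y" using add[of "x - y" y] by (simp add: algebra_simps)
qed

text \<open>The coordinates on \<open>K\<close> become the plane with third coordinate 0. The
  extension to the whole space only has to be linear over the small field.\<close>

lemma extend_field_reduction:
  fixes \<iota> :: "'q::{field,finite} \<Rightarrow> 'k::{field,finite}" and \<psi> :: "'k ^ 2 \<Rightarrow> 'q ^ 'm"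
  assumes emb: "field_embedding \<iota>" and \<psi>: "field_reduction \<iota> \<psi> K"
    and card: "CARD('k) ^ 3 = CARD('q) ^ CARD('m)"
  obtains \<phi> :: "'k ^ 3 \<Rightarrow> 'q ^ 'm" where
    "field_reduction \<iota> \<phi> UNIV" "\<And>x y. \<phi> (vector [x, y, 0]) = \<psi> (vector [x, y])"
proof -
  let ?s = "\<lambda>c (x :: 'k ^ 3). \<iota> c *s x"
  interpret s1: vector_space ?s by (rule vector_space_restrict_scalars[OF emb])
  interpret p: vector_space_pair ?s "(*s) :: 'q \<Rightarrow> 'q ^ 'm \<Rightarrow> 'q ^ 'm" ..
  \<comment> \<open>Forgetting the third coordinate makes \<open>f\<close> linear everywhere, but
    injectivity is available only on \<open>?S\<close>.\<close>
  define f where "f v = \<psi> (vector [v $ 1, v $ 2])" for v :: "'k ^ 3"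
  let ?S = "{v :: 'k ^ 3. v $ 3 = 0}"
  have f: "Vector_Spaces.linear ?s (*s) f"
    unfolding Vector_Spaces.linear_iff
  proof (intro conjI allI)
    fix x y :: "'k ^ 3" and c
    have "vector [(x + y) $ 1, (x + y) $ 2] = (vector [x $ 1, x $ 2] + vector [y $ 1, y $ 2] :: 'k ^ 2)"
      by (rule vec_2_eqI) simp_all
    then show "f (x + y) = f x + f y" by (simp only: f_def field_reductionD[OF \<psi>])
    have "vector [(\<iota> c *s x) $ 1, (\<iota> c *s x) $ 2] = (\<iota> c *s vector [x $ 1, x $ 2] :: 'k ^ 2)"
      by (rule vec_2_eqI) simp_all
    then show "f (\<iota> c *s x) = c *s f x" by (simp only: f_def field_reductionD[OF \<psi>])
  qed unfold_locales
  have S: "s1.subspace ?S" by (auto simp: s1.subspace_def)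
  have inj: "inj_on f ?S"
  proof (rule inj_onI)
    fix u v assume uv: "u \<in> ?S" "v \<in> ?S" "f u = f v"
    then have "(vector [u $ 1, u $ 2] :: 'k ^ 2) = vector [v $ 1, v $ 2]"
      by (simp add: f_def field_reductionD[OF \<psi>])
    then have "u $ 1 = v $ 1" "u $ 2 = v $ 2" by (metis vector_2)+
    then show "u = v" using uv by (intro vec_3_eqI) auto
  qed
  have "CARD('k ^ 3) = CARD('q ^ 'm)" using card by simp
  then obtain h where h: "Vector_Spaces.linear ?s (*s) h" "bij h" "\<And>x. x \<in> ?S \<Longrightarrow> h x = f x"
    using p.extend_injective_linear[OF finite finite finite _ f S inj] by metis
  show thesis
  proof (rule that[of h])
    show "field_reduction \<iota> h UNIV" using h by (auto simp: field_reduction_def bij_def)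
    show "h (vector [x, y, 0]) = \<psi> (vector [x, y])" for x y
      using h(3)[of "vector [x, y, 0]"] by (simp add: f_def)
  qed
qed

text \<open>The preimage \<open>M\<close> of \<open>L\<close> meets the plane w = 0 in a line over
  the big field, which supplies \<open>a\<close> and \<open>b\<close>. By counting, every third
  coordinate occurs in \<open>M\<close>, and on \<open>M\<close> the value of a x + b y depends on
  that coordinate alone; this function is \<open>g\<close>.\<close>

lemma line_equation:
  fixes \<iota> :: "'q::{field,finite} \<Rightarrow> 'k::{field,finite}" and \<psi> :: "'k ^ 2 \<Rightarrow> 'q ^ 'm"
    and \<phi> :: "'k ^ 3 \<Rightarrow> 'q ^ 'm"
  assumes \<phi>: "field_reduction \<iota> \<phi> UNIV" and \<psi>: "field_reduction \<iota> \<psi> K"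
    and ext: "\<And>x y. \<phi> (vector [x, y, 0]) = \<psi> (vector [x, y])"
    and L: "vec.subspace L" "card L = CARD('k) ^ 2"
    and P: "P \<in> proj_points" "L \<inter> K = \<psi> ` P"
  shows "\<exists>a b g. (a \<noteq> 0 \<or> b \<noteq> 0) \<and> (\<forall>v w. g (v + w) = g v + g w) \<and> (\<forall>c w. g (\<iota> c * w) = \<iota> c * g w) \<and>
    (\<forall>x y w. \<phi> (vector [x, y, w]) \<in> L \<longleftrightarrow> a * x + b * y = g w)"
proof -
  note \<phi>s = field_reductionD[OF \<phi>]
  obtain p where p: "p \<noteq> 0" "P = vec.span {p}" using P(1) unfolding proj_point_iff by blast
  \<comment> \<open>The linear form whose zeros are the multiples of \<open>p\<close>.\<close>
  define a b where "a = - p $ 2" and "b = p $ 1"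
  have ab: "a \<noteq> 0 \<or> b \<noteq> 0" using p(1) by (auto simp: a_def b_def vec_eq_iff forall_2)
  define M where "M = {v. \<phi> v \<in> L}"
  have M_add: "u + v \<in> M" and M_diff: "u - v \<in> M" and M_scale: "\<iota> c *s u \<in> M"
    if "u \<in> M" "v \<in> M" for u v c
    using that L(1) by (auto simp: M_def \<phi>s vec.subspace_add vec.subspace_diff vec.subspace_scale)
  have M0: "vector [x, y, 0] \<in> M \<longleftrightarrow> (\<exists>s. x = s * p $ 1 \<and> y = s * p $ 2)" for x y
  proof -
    have "\<psi> (vector [x, y]) \<in> K" using \<psi> by (auto simp: field_reduction_def)
    then have "vector [x, y, 0] \<in> M \<longleftrightarrow> \<psi> (vector [x, y]) \<in> \<psi> ` P"
      unfolding P(2)[symmetric] M_def by (simp add: ext)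
    also have "\<dots> \<longleftrightarrow> vector [x, y] \<in> P" using field_reductionD(3)[OF \<psi>] by auto
    also have "\<dots> \<longleftrightarrow> (\<exists>s. vector [x, y] = s *s p)" unfolding p(2) vec.span_singleton by auto
    also have "\<dots> \<longleftrightarrow> (\<exists>s. x = s * p $ 1 \<and> y = s * p $ 2)" by (simp add: vec_eq_iff forall_2)
    finally show ?thesis .
  qed
  have M0': "vector [x, y, 0] \<in> M \<longleftrightarrow> a * x + b * y = 0" for x y
    unfolding M0
  proof
    assume "a * x + b * y = 0"
    then have *: "x * p $ 2 = y * p $ 1" by (simp add: a_def b_def algebra_simps)
    have "p $ 1 \<noteq> 0 \<or> p $ 2 \<noteq> 0" using ab by (auto simp: a_def b_def)
    then obtain s where "x = s * p $ 1" "y = s * p $ 2" using * by (rule binary_proportional)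
    then show "\<exists>s. x = s * p $ 1 \<and> y = s * p $ 2" by blast
  qed (auto simp: a_def b_def)
  have split: "v = vector [v $ 1, v $ 2, v $ 3]" for v :: "'k ^ 3" by (rule vec_3_eqI) simp_all
  have M_zero_third: "a * v $ 1 + b * v $ 2 = 0" if "v \<in> M" "v $ 3 = 0" for v
    using that M0' split[of v] by metis
  have "card (\<phi> ` M) = card L"
    using \<phi> by (intro arg_cong[of _ _ card]) (auto simp: M_def field_reduction_def image_iff)
  moreover have "inj_on \<phi> M" using \<phi> by (auto simp: field_reduction_def intro: inj_on_subset)
  ultimately have cardM: "card M = CARD('k) ^ 2" using L(2) card_image by metis
  define Z where "Z = (\<lambda>v. v $ 3) ` M"
  have "\<forall>z\<in>Z. \<exists>v. v \<in> M \<and> v $ 3 = z" by (auto simp: Z_def)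
  then obtain c where c: "\<And>z. z \<in> Z \<Longrightarrow> c z \<in> M \<and> c z $ 3 = z" by metis
  \<comment> \<open>Each fibre of the third coordinate is contained in a translate of the line
    spanned by \<open>p\<close>. As \<open>M\<close> has \<open>CARD('k) ^ 2\<close> elements, at
    least \<open>CARD('k)\<close> fibres are nonempty.\<close>
  have "M \<subseteq> (\<lambda>(z, s). c z + vector [s * p $ 1, s * p $ 2, 0]) ` (Z \<times> UNIV)"
  proof
    fix v assume v: "v \<in> M"
    then have z: "v $ 3 \<in> Z" by (auto simp: Z_def)
    let ?d = "v - c (v $ 3)"
    have "?d \<in> M" "?d $ 3 = 0" using M_diff v c[OF z] by auto
    then obtain s where "?d $ 1 = s * p $ 1" "?d $ 2 = s * p $ 2" using M0 split[of ?d] by metis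
    then have "v = c (v $ 3) + vector [s * p $ 1, s * p $ 2, 0]"
      using c[OF z] by (intro vec_3_eqI) (auto simp: algebra_simps)
    then show "v \<in> (\<lambda>(z, s). c z + vector [s * p $ 1, s * p $ 2, 0]) ` (Z \<times> UNIV)"
      using z by (intro image_eqI[of _ _ "(v $ 3, s)"]) auto
  qed
  from surj_card_le[OF _ this] have "card M \<le> card Z * CARD('k)"
    by (simp add: card_cartesian_product)
  then have "CARD('k) \<le> card Z" unfolding cardM by (simp add: power2_eq_square)
  then have "Z = UNIV" by (metis card_seteq finite subset_UNIV)
  with c have c: "c z \<in> M" "c z $ 3 = z" for z by auto
  \<comment> \<open>The choice of \<open>c z\<close> is immaterial: two choices differ by an element
    of \<open>M\<close> with third coordinate 0, where the form vanishes.\<close>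
  define g where "g z = a * c z $ 1 + b * c z $ 2" for z
  have M: "v \<in> M \<longleftrightarrow> a * v $ 1 + b * v $ 2 = g (v $ 3)" for v
  proof -
    let ?d = "v - c (v $ 3)"
    have "v \<in> M \<longleftrightarrow> ?d \<in> M" using M_add[of ?d "c (v $ 3)"] M_diff[of v] c by auto
    also have "\<dots> \<longleftrightarrow> a * ?d $ 1 + b * ?d $ 2 = 0" using M0'[of "?d $ 1" "?d $ 2"] split[of ?d] c by simp
    also have "\<dots> \<longleftrightarrow> a * v $ 1 + b * v $ 2 = g (v $ 3)" by (simp add: g_def algebra_simps)
    finally show ?thesis .
  qed
  have "g (v + w) = g v + g w" for v w
    using M[of "c v + c w"] M_add[OF c(1) c(1), of v w] c by (simp add: g_def algebra_simps)
  moreover have "g (\<iota> d * w) = \<iota> d * g w" for d w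
    using M[of "\<iota> d *s c w"] M_scale[OF c(1) c(1), of d w] c by (simp add: g_def algebra_simps)
  moreover have "\<phi> (vector [x, y, w]) \<in> L \<longleftrightarrow> a * x + b * y = g w" for x y w
    using M[of "vector [x, y, w]"] by (simp add: M_def)
  ultimately show ?thesis using ab by blast
qed

section \<open>Dualities from bilinear forms\<close>

definition perp :: "('v \<Rightarrow> 'v \<Rightarrow> 'q::zero) \<Rightarrow> 'v set \<Rightarrow> 'v set" where
  "perp \<beta> U = {y. \<forall>x\<in>U. \<beta> x y = 0}"

text \<open>Nondegeneracy makes \<open>y \<mapsto> \<beta> _ y\<close> injective into the linear
  forms, hence surjective by finiteness. A form separating \<open>x\<close> from \<open>U\<close> is
  therefore given by a vector of \<open>perp \<beta> U\<close>, which yields that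
  \<open>perp \<beta>\<close> is an involution on subspaces.\<close>

lemma duality_perp:
  fixes \<beta> :: "'q::{field,finite} ^ 'm \<Rightarrow> 'q ^ 'm \<Rightarrow> 'q"
  assumes add: "\<And>x y z. \<beta> (x + y) z = \<beta> x z + \<beta> y z" and scale: "\<And>c x z. \<beta> (c *s x) z = c * \<beta> x z"
    and sym: "\<And>x y. \<beta> x y = \<beta> y x" and nondeg: "\<And>y. (\<And>x. \<beta> x y = 0) \<Longrightarrow> y = 0"
  shows "duality (perp \<beta>)"
proof -
  have zero: "\<beta> 0 z = 0" for z using scale[of 0 0 z] by simp
  have subspace: "vec.subspace (perp \<beta> U)" for U
  proof -
    have "\<beta> x (y + z) = \<beta> x y + \<beta> x z" "\<beta> x (c *s y) = c * \<beta> x y" "\<beta> x 0 = 0" for x y z c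
      using add scale sym zero by metis+
    then show ?thesis by (auto simp: vec.subspace_def perp_def)
  qed
  define N where "N y = (\<chi> i. \<beta> (axis i 1) y)" for y
  have \<beta>: "\<beta> x y = dot (N y) x" for x y
  proof -
    have "\<beta> (\<Sum>i\<in>S. x $ i *s axis i 1) y = (\<Sum>i\<in>S. x $ i * \<beta> (axis i 1) y)" for S
      by (induction S rule: infinite_finite_induct) (auto simp: zero add scale)
    from this[of UNIV] show ?thesis by (simp add: basis_expansion N_def dot_def mult.commute)
  qed
  have "inj N"
  proof (rule injI)
    fix y z assume "N y = N z"
    then have "\<beta> x y = \<beta> x z" for x by (simp add: \<beta>)
    then have "\<beta> x (y - z) = 0" for x
      by (metis add sym diff_add_cancel add_cancel_left_left)
    then have "y - z = 0" by (rule nondeg)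
    then show "y = z" by simp
  qed
  then have surj: "surj N" by (simp add: finite_UNIV_inj_surj)
  have invol: "perp \<beta> (perp \<beta> U) = U" if U: "vec.subspace U" for U
  proof (intro equalityI subsetI, rule ccontr)
    fix x assume x: "x \<in> perp \<beta> (perp \<beta> U)" "x \<notin> U"
    then obtain c where c: "\<forall>u\<in>U. dot c u = 0" "dot c x \<noteq> 0" using separating_functional[OF U] by blast
    obtain y where "c = N y" using surj by blast
    then have "y \<in> perp \<beta> U" "\<beta> y x \<noteq> 0" using c \<beta> sym[of y x] by (auto simp: perp_def)
    then show False using x(1) by (auto simp: perp_def)
  qed (auto simp: perp_def sym)
  have anti: "U \<subseteq> W \<Longrightarrow> perp \<beta> W \<subseteq> perp \<beta> U" for U W by (auto simp: perp_def)
  have "bij_betw (perp \<beta>) {U. vec.subspace U} {U. vec.subspace U}"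
    by (rule bij_betw_byWitness[where f' = "perp \<beta>"]) (use invol subspace in auto)
  moreover have "U \<subseteq> W \<longleftrightarrow> perp \<beta> W \<subseteq> perp \<beta> U" if "vec.subspace U" "vec.subspace W" for U W
    using anti[of U W] anti[of "perp \<beta> W" "perp \<beta> U"] invol that by auto
  ultimately show ?thesis unfolding duality_def by blast
qed

text \<open>Plays the part of the field trace: it turns bilinear forms over the big field into forms
  over the small one. The value 1 at 1 ensures nondegeneracy.\<close>

lemma nonzero_linear_functional:
  fixes \<iota> :: "'q::field \<Rightarrow> 'k::field"
  assumes "field_embedding \<iota>"
  obtains \<tau> :: "'k \<Rightarrow> 'q" where "\<And>x y. \<tau> (x + y) = \<tau> x + \<tau> y" "\<And>c x. \<tau> (\<iota> c * x) = c * \<tau> x" "\<tau> 1 = 1"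
proof -
  let ?s = "\<lambda>c x. \<iota> c * x"
  have "vector_space ?s" using assms by (auto simp: vector_space_def field_embedding_def algebra_simps)
  moreover have "vector_space ((*) :: 'q \<Rightarrow> 'q \<Rightarrow> 'q)" by (auto simp: vector_space_def algebra_simps)
  ultimately interpret p: vector_space_pair ?s "(*) :: 'q \<Rightarrow> 'q \<Rightarrow> 'q"
    by (simp add: vector_space_pair_def)
  have "p.vs1.independent {1}" by simp
  then obtain \<tau> where "Vector_Spaces.linear ?s (*) \<tau>" "\<tau> 1 = 1"
    using p.linear_independent_extend[of "{1}" "\<lambda>_. 1"] by auto
  then show thesis using that by (auto simp: Vector_Spaces.linear_iff)
qed

lemma conic_vecs_on_conic:
  assumes "odd CARD('k::{field,finite})"
  obtains C :: "('k::{field,finite} ^ 3) set set" where "conic C" "\<And>c. c \<in> conic_vecs \<Longrightarrow> vec.span {c} \<in> C"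
proof -
  \<comment> \<open>The matrix of 2 (x2^2 - x1 x3).\<close>
  define A :: "'k ^ 3 ^ 3" where "A = vector [vector [0, 0, -1], vector [0, 2, 0], vector [-1, 0, 0]]"
  define C where "C = {P \<in> proj_points. \<forall>x\<in>P. (\<Sum>i\<in>UNIV. \<Sum>j\<in>UNIV. A $ i $ j * x $ i * x $ j) = 0}"
  have "transpose A = A" by (simp add: A_def vec_eq_iff forall_3 transpose_def)
  moreover have "det A \<noteq> 0" using two_neq_zero_odd_card[OF assms] by (simp add: A_def det_3)
  ultimately have "conic C" unfolding conic_def C_def by blast
  moreover have "vec.span {c} \<in> C" if c: "c \<in> conic_vecs" for c
  proof -
    have "c \<noteq> 0" using c zero_notin_conic_vecs by metis
    moreover have "quad A c = 0" using c by (auto simp: conic_vecs_def quad_def sum_3 A_def)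
    then have "quad A x = 0" if "x \<in> vec.span {c}" for x
      using that by (auto simp: vec.span_singleton quad_scale)
    ultimately show ?thesis by (auto simp: C_def quad_def intro: span_singleton_in_proj_points)
  qed
  ultimately show thesis using that by blast
qed

text \<open>The functional \<open>\<tau>\<close> applied to the standard dot product is a
  nondegenerate form over the small field. Its polarity sends the reduction of the point spanned by
  \<open>c\<close> to the reduction of the line with equation \<open>c\<close>, so it carries the
  pseudo-conic to the required elements.\<close>

lemma dual_pseudo_conic_of_conic_vecs:
  fixes \<iota> :: "'q::{field,finite} \<Rightarrow> 'k::{field,finite}" and \<phi> :: "'k ^ 3 \<Rightarrow> 'q ^ 'm"
  assumes emb: "field_embedding \<iota>" and odd: "odd CARD('k)" and \<phi>: "field_reduction \<iota> \<phi> UNIV"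
    and \<K>: "\<And>L. L \<in> \<K> \<Longrightarrow> \<exists>c\<in>conic_vecs. L = \<phi> ` {z. dot c z = 0}"
  shows "\<exists>\<D>. dual_pseudo_conic \<iota> \<D> \<and> \<K> \<subseteq> \<D>"
proof -
  note \<phi>s = field_reductionD[OF \<phi>]
  have \<phi>_inv: "\<phi> (inv \<phi> y) = y" "inv \<phi> (\<phi> z) = z" for y z
    using \<phi> by (auto simp: field_reduction_def f_inv_into_f inv_f_f)
  have inv_add: "inv \<phi> (x + y) = inv \<phi> x + inv \<phi> y" and inv_scale: "inv \<phi> (c *s x) = \<iota> c *s inv \<phi> x" for x y c
    using \<phi>s(1)[of "inv \<phi> x" "inv \<phi> y"] \<phi>s(2)[of c "inv \<phi> x"] \<phi>_inv by metis+
  obtain \<tau> :: "'k \<Rightarrow> 'q" where \<tau>: "\<And>x y. \<tau> (x + y) = \<tau> x + \<tau> y" "\<And>c x. \<tau> (\<iota> c * x) = c * \<tau> x" "\<tau> 1 = 1"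
    using nonzero_linear_functional[OF emb] by metis
  have \<tau>0: "\<tau> 0 = 0" using \<tau>(1)[of 0 0] by (metis add_0 add_cancel_right_right)
  have \<tau>_nondeg: "z = 0" if "\<And>s. \<tau> (s * z) = 0" for z
  proof (rule ccontr)
    assume "z \<noteq> 0"
    then show False using that[of "inverse z"] \<tau>(3) by simp
  qed
  define \<beta> where "\<beta> x y = \<tau> (dot (inv \<phi> x) (inv \<phi> y))" for x y
  have dual: "duality (perp \<beta>)"
  proof (rule duality_perp)
    show "y = 0" if "\<And>x. \<beta> x y = 0" for y
    proof -
      have "dot c (inv \<phi> y) = 0" for c
        using that[of "\<phi> (s *s c)" for s] by (intro \<tau>_nondeg) (simp add: \<beta>_def \<phi>_inv dot_scale)
      then have "inv \<phi> y = 0" by (metis dot_commute dot_eq_0_all)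
      then show "y = 0" using \<phi>_inv(1)[of y] \<phi>s(4) by simp
    qed
  qed (simp_all add: \<beta>_def inv_add inv_scale dot_add dot_scale \<tau> dot_commute)
  have perp: "perp \<beta> (\<phi> ` vec.span {c}) = \<phi> ` {z. dot c z = 0}" for c
  proof -
    have "y \<in> perp \<beta> (\<phi> ` vec.span {c}) \<longleftrightarrow> dot c (inv \<phi> y) = 0" for y
    proof -
      \<comment> \<open>The point contains all multiples of \<open>c\<close> by big scalars
        \<open>s\<close>; vanishing of \<open>\<tau>\<close> for all of them is vanishing over the
        big field.\<close>
      have "y \<in> perp \<beta> (\<phi> ` vec.span {c}) \<longleftrightarrow> (\<forall>s. \<tau> (s * dot c (inv \<phi> y)) = 0)"
        by (simp add: perp_def vec.span_singleton \<beta>_def \<phi>_inv dot_scale)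
      then show ?thesis using \<tau>_nondeg \<tau>0 by auto
    qed
    moreover have "y \<in> \<phi> ` {z. dot c z = 0} \<longleftrightarrow> dot c (inv \<phi> y) = 0" for y
      using \<phi>_inv by (metis (mono_tags, lifting) image_iff mem_Collect_eq)
    ultimately show ?thesis by blast
  qed
  obtain C :: "('k ^ 3) set set" where C: "conic C" "\<And>c. c \<in> conic_vecs \<Longrightarrow> vec.span {c} \<in> C"
    using conic_vecs_on_conic[OF odd] by metis
  define \<D> where "\<D> = perp \<beta> ` (\<lambda>P. \<phi> ` P) ` C"
  have "dual_pseudo_conic \<iota> \<D>"
    unfolding dual_pseudo_conic_def pseudo_conic_def \<D>_def using dual \<phi> C(1) by blast
  moreover have "\<K> \<subseteq> \<D>"
  proof
    fix L assume "L \<in> \<K>"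
    then obtain c where "c \<in> conic_vecs" "L = \<phi> ` {z. dot c z = 0}" using \<K> by blast
    then show "L \<in> \<D>" unfolding \<D>_def perp[symmetric] using C(2) by blast
  qed
  ultimately show ?thesis by blast
qed

text \<open>For \<open>n = 1\<close> the embedding is an injection between sets of equal finite
  size; for larger \<open>n\<close> the big field has at least 9 elements.\<close>

lemma surj_or_large_field:
  fixes \<iota> :: "'q::{field,finite} \<Rightarrow> 'k::{field,finite}"
  assumes odd: "odd CARD('q)" and "n \<ge> 1" and emb: "field_embedding \<iota>" and card: "CARD('k) = CARD('q) ^ n"
  shows "surj \<iota> \<or> 7 \<le> CARD('k)"
proof (cases "n = 1")
  case True
  have "inj \<iota>"
  proof (rule injI, rule ccontr)
    fix x y assume eq: "\<iota> x = \<iota> y" and "x \<noteq> y"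
    have diff: "\<iota> (x - y) = 0"
      using emb eq unfolding field_embedding_def by (metis add_cancel_left_left diff_add_cancel)
    have "1 = \<iota> ((x - y) * inverse (x - y))"
      using \<open>x \<noteq> y\<close> emb by (simp add: field_embedding_def)
    also have "\<dots> = 0" using emb diff by (metis field_embedding_def mult_zero_left)
    finally show False by simp
  qed
  then have "card (range \<iota>) = CARD('k)" using card True by (simp add: card_image)
  then show ?thesis by (metis card_subset_eq finite subset_UNIV)
next
  case False
  then have "2 \<le> n" using \<open>n \<ge> 1\<close> by linarith
  have "(3::nat) ^ 2 \<le> CARD('q) ^ 2" using card_odd_field_ge_3[OF odd] by (rule power_mono) simp
  also have "\<dots> \<le> CARD('q) ^ n" using \<open>2 \<le> n\<close> by (rule power_increasing) simp
  finally show ?thesis using card by simp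
qed

section \<open>From the Desarguesian spread to the dual pseudo-conic\<close>

theorem theorem7p9:
  fixes \<iota> :: "'q::{field,finite} \<Rightarrow> 'k::{field,finite}"
    and n :: nat
    and \<K> :: "('q ^ 'm) set set"
    and K :: "('q ^ 'm) set"
  assumes "odd CARD('q)"
    and "n \<ge> 1"
    and "CARD('m) = 3 * n"
    and "field_embedding \<iota>"
    and "CARD('k) = CARD('q) ^ n"
    and "dual_pseudo_arc n \<K>"
    and "card \<K> > m2' TYPE('k)"
    and "K \<in> \<K>"
    and "\<exists>D. desarguesian_spread \<iota> K D \<and> {L \<inter> K | L. L \<in> \<K> \<and> L \<noteq> K} \<subseteq> D"
  shows "\<exists>\<D>. dual_pseudo_conic \<iota> \<D> \<and> \<K> \<subseteq> \<D>"
proof -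
  note emb = assms(4) and arc = assms(6)
  have odd_k: "odd CARD('k)" using assms(1,5) by simp
  obtain \<psi> :: "'k ^ 2 \<Rightarrow> 'q ^ 'm" where \<psi>: "field_reduction \<iota> \<psi> K"
      "{L \<inter> K | L. L \<in> \<K> \<and> L \<noteq> K} \<subseteq> (\<lambda>P. \<psi> ` P) ` proj_points"
    using assms(9) unfolding desarguesian_spread_def by blast
  have "CARD('k) ^ 3 = CARD('q) ^ CARD('m)"
    unfolding assms(3,5) by (simp add: power_mult[symmetric] mult.commute)
  then obtain \<phi> :: "'k ^ 3 \<Rightarrow> 'q ^ 'm" where \<phi>: "field_reduction \<iota> \<phi> UNIV"
      and ext: "\<And>x y. \<phi> (vector [x, y, 0]) = \<psi> (vector [x, y])"
    using extend_field_reduction[OF emb \<psi>(1)] by metis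
  note \<phi>s = field_reductionD[OF \<phi>]
  have \<phi>_surj: "\<exists>v. y = \<phi> v" for y using \<phi> unfolding field_reduction_def by blast
  have in_K: "\<phi> v \<in> K \<longleftrightarrow> v $ 3 = 0" for v
  proof -
    have "\<phi> v \<in> K \<longleftrightarrow> (\<exists>u. \<phi> v = \<psi> u)" using \<psi>(1) by (auto simp: field_reduction_def)
    also have "\<dots> \<longleftrightarrow> (\<exists>u :: 'k ^ 2. v = vector [u $ 1, u $ 2, 0])"
    proof -
      have "\<psi> u = \<phi> (vector [u $ 1, u $ 2, 0])" for u
        unfolding ext by (rule arg_cong[of _ _ \<psi>], rule vec_2_eqI) simp_all
      then show ?thesis by (simp add: \<phi>s(3))
    qed
    also have "\<dots> \<longleftrightarrow> v $ 3 = 0"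
      by (auto simp: vec_eq_iff forall_3 intro!: exI[of _ "vector [v $ 1, v $ 2]"])
    finally show ?thesis .
  qed
  define I where "I = \<K> - {K}"
  define line where "line L a b g \<longleftrightarrow> (a \<noteq> 0 \<or> b \<noteq> 0) \<and> (\<forall>v w. g (v + w) = g v + g w) \<and>
    (\<forall>c w. g (\<iota> c * w) = \<iota> c * g w) \<and> (\<forall>x y w. \<phi> (vector [x, y, w]) \<in> L \<longleftrightarrow> a * x + b * y = g w)" for L a b g
  have "\<exists>a b g. line L a b g" if "L \<in> I" for L
  proof -
    have L: "vec.subspace L" "vec.dim L = 2 * n" using arc that by (auto simp: I_def dual_pseudo_arc_def)
    have "L \<inter> K \<in> (\<lambda>P. \<psi> ` P) ` proj_points" using \<psi>(2) that by (auto simp: I_def)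
    then obtain P where P: "P \<in> proj_points" "L \<inter> K = \<psi> ` P" by blast
    have "card L = CARD('k) ^ 2"
      unfolding card_subspace[OF L(1)] L(2) assms(5) by (simp add: power_mult[symmetric] mult.commute)
    then show ?thesis unfolding line_def by (rule line_equation[OF \<phi> \<psi>(1) ext L(1) _ P])
  qed
  then obtain a b g where "\<And>L. L \<in> I \<Longrightarrow> line L (a L) (b L) (g L)" by metis
  then have
      ab: "\<And>L. L \<in> I \<Longrightarrow> a L \<noteq> 0 \<or> b L \<noteq> 0"
      and g_add: "\<And>L v w. L \<in> I \<Longrightarrow> g L (v + w) = g L v + g L w"
      and g_scale: "\<And>L c w. L \<in> I \<Longrightarrow> g L (\<iota> c * w) = \<iota> c * g L w"
      and in_L: "\<And>L x y w. L \<in> I \<Longrightarrow> \<phi> (vector [x, y, w]) \<in> L \<longleftrightarrow> a L * x + b L * y = g L w"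
    unfolding line_def by blast+
  have triple_Int: "v = 0" if "\<phi> v \<in> L" "\<phi> v \<in> M" "\<phi> v \<in> N" "L \<in> \<K>" "M \<in> \<K>" "N \<in> \<K>" "L \<noteq> M" "L \<noteq> N" "M \<noteq> N" for L M N v
  proof -
    have "\<phi> v \<in> L \<inter> M \<inter> N" "L \<inter> M \<inter> N = {0}" using that arc unfolding dual_pseudo_arc_def by blast+
    then show ?thesis using \<phi>s(3)[of v 0] \<phi>s(4) by simp
  qed
  interpret line_family \<iota> I a b g
  proof
    show "odd CARD('k)" by fact
    show "finite I" by simp
    show "a L * b M \<noteq> a M * b L" if "L \<in> I" "M \<in> I" "L \<noteq> M" for L M
    proof
      assume eq: "a L * b M = a M * b L"
      have g0: "g N 0 = 0" if "N \<in> I" for N using g_add[OF that, of 0 0] by (metis add_0 add_cancel_right_right)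
      \<comment> \<open>If the two linear parts were proportional, this vector would represent a
        common nonzero point of \<open>L\<close>, \<open>M\<close> and \<open>K\<close>.\<close>
      let ?v = "vector [- b L, a L, 0] :: 'k ^ 3"
      have "\<phi> ?v \<in> L" "\<phi> ?v \<in> M" using in_L g0 that eq by (simp_all add: mult.commute)
      moreover have "\<phi> ?v \<in> K" by (simp add: in_K)
      ultimately have "?v = 0" using triple_Int[of ?v L M K] that assms(8) by (auto simp: I_def)
      then have "?v $ 1 = 0" "?v $ 2 = 0" by (simp_all only: zero_index)
      then show False using ab[OF \<open>L \<in> I\<close>] by simp
    qed
    show False if "L \<in> I" "M \<in> I" "N \<in> I" "L \<noteq> M" "L \<noteq> N" "M \<noteq> N" "w \<noteq> 0"
      "a L * x + b L * y = g L w" "a M * x + b M * y = g M w" "a N * x + b N * y = g N w" for L M N w x y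
    proof -
      let ?v = "vector [x, y, w] :: 'k ^ 3"
      have "?v = 0" using triple_Int[of ?v L M N] that in_L by (auto simp: I_def)
      then have "?v $ 3 = 0" by (simp only: zero_index)
      then show False using \<open>w \<noteq> 0\<close> by simp
    qed
    have "card \<K> = card I + 1"
      unfolding I_def using assms(8) card_Suc_Diff1[of \<K> K] by simp
    then show "m2' TYPE('k) < card I + 1" using assms(7) by simp
    show "surj \<iota> \<or> 7 \<le> CARD('k)" by (rule surj_or_large_field) fact+
  qed (use ab g_add g_scale in auto)
  obtain u1 u2 v1 v2 \<rho> t A B C where uv: "u1 * v2 - u2 * v1 \<noteq> (0::'k)"
    and \<rho>: "\<And>L. L \<in> I \<Longrightarrow> \<rho> L \<noteq> 0 \<and> a L = \<rho> L * (u1 + t L * v1) \<and> b L = \<rho> L * (u2 + t L * v2)"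
    and g: "\<And>L w. L \<in> I \<Longrightarrow> g L w = \<rho> L * (A w + B w * t L + C w * t L ^ 2)"
    and lin: "\<iota>_linear A" "\<iota>_linear B" "\<iota>_linear C" and C0: "\<And>w. w \<noteq> 0 \<Longrightarrow> C w \<noteq> 0"
    using normal_form by metis
  \<comment> \<open>Collecting powers of t in (u + t v) . (x, y) = A w + B w t + C w t^2 gives X + t
    Y + t^2 Z = 0 with these X, Y, Z. The map is linear over the small field only.\<close>
  define T where "T v = (vector [u1 * v $ 1 + u2 * v $ 2 - A (v $ 3), v1 * v $ 1 + v2 * v $ 2 - B (v $ 3), - C (v $ 3)] :: 'k ^ 3)"
    for v :: "'k ^ 3"
  have add: "A (v + w) = A v + A w" "B (v + w) = B v + B w" "C (v + w) = C v + C w"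
    and scale: "A (\<iota> c * w) = \<iota> c * A w" "B (\<iota> c * w) = \<iota> c * B w" "C (\<iota> c * w) = \<iota> c * C w" for v w c
    using lin by (auto simp: \<iota>_linear_def)
  have T_add: "T (v + w) = T v + T w" for v w
    by (rule vec_3_eqI) (simp_all add: T_def add algebra_simps)
  have T_scale: "T (\<iota> c *s v) = \<iota> c *s T v" for v c
    by (rule vec_3_eqI) (simp_all add: T_def scale distrib_left right_diff_distrib mult.left_commute)
  have C_0: "C 0 = 0" "A 0 = 0" "B 0 = 0" using lin by (metis \<iota>_linear_def add_0 add_cancel_right_right)+
  \<comment> \<open>\<open>C\<close> vanishes only at 0, which forces w = 0; the nonzero determinant
    \<open>uv\<close> then disposes of x and y.\<close>
  have T_0: "v = 0" if "T v = 0" for v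
  proof -
    have "T v $ 1 = 0" "T v $ 2 = 0" "T v $ 3 = 0" using that by simp_all
    note T_v = this
    then have v3: "v $ 3 = 0" using C0[of "v $ 3"] by (auto simp: T_def)
    then have "u1 * v $ 1 + u2 * v $ 2 = 0" "v1 * v $ 1 + v2 * v $ 2 = 0"
      using T_v C_0 by (auto simp: T_def)
    then have "v $ 1 * (u1 * v2 - u2 * v1) = 0" "v $ 2 * (u1 * v2 - u2 * v1) = 0" by algebra+
    then show ?thesis using uv v3 by (intro vec_3_eqI) auto
  qed
  have "inj T"
  proof (rule injI)
    fix v w assume "T v = T w"
    then have "T (v - w) = 0" using T_add[of "v - w" w] by simp
    then show "v = w" using T_0 by force
  qed
  then have bij: "bij T" by (simp add: bij_def finite_UNIV_inj_surj)
  have T_inv: "T (inv T z) = z" "inv T (T v) = v" for z v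
    using bij by (auto simp: bij_def surj_f_inv_f inv_f_f)
  \<comment> \<open>A second identification with the big coordinate space, in which the elements of
    \<open>\<K>\<close> become lines over the big field.\<close>
  define \<phi>' where "\<phi>' z = \<phi> (inv T z)" for z
  have \<phi>': "field_reduction \<iota> \<phi>' UNIV"
    unfolding field_reduction_def Vector_Spaces.linear_iff
  proof (intro conjI allI)
    show "vector_space (\<lambda>c (x :: 'k ^ 3). \<iota> c *s x)" by (rule vector_space_restrict_scalars[OF emb])
    show "vector_space ((*s) :: 'q \<Rightarrow> 'q ^ 'm \<Rightarrow> 'q ^ 'm)" by unfold_locales
    fix x y :: "'k ^ 3" and c
    have "inv T (x + y) = inv T x + inv T y" "inv T (\<iota> c *s x) = \<iota> c *s inv T x"
      using T_add T_scale T_inv by metis+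
    then show "\<phi>' (x + y) = \<phi>' x + \<phi>' y" "\<phi>' (\<iota> c *s x) = c *s \<phi>' x" by (simp_all add: \<phi>'_def \<phi>s)
  next
    show "inj \<phi>'" by (rule injI) (metis \<phi>'_def \<phi>s(3) T_inv(1))
    show "range \<phi>' = UNIV" using \<phi>_surj T_inv(2) by (metis \<phi>'_def surj_def)
  qed
  have "\<exists>c\<in>conic_vecs. \<forall>v. \<phi> v \<in> L \<longleftrightarrow> dot c (T v) = 0" if "L \<in> \<K>" for L
  proof (cases "L = K")
    case True
    \<comment> \<open>\<open>K\<close> itself is the parameter infinity: Z = - C w vanishes exactly
      for w = 0.\<close>
    have "dot (vector [0, 0, 1]) (T v) = 0 \<longleftrightarrow> v $ 3 = 0" for v
      using C0[of "v $ 3"] C_0 by (auto simp: dot_3 T_def)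
    then show ?thesis using True in_K by (intro bexI[of _ "vector [0, 0, 1]"]) (auto simp: conic_vecs_def)
  next
    case False
    then have L: "L \<in> I" using that by (simp add: I_def)
    have "\<phi> v \<in> L \<longleftrightarrow> dot (vector [1, t L, t L * t L]) (T v) = 0" for v
    proof -
      have "v = vector [v $ 1, v $ 2, v $ 3]" by (rule vec_3_eqI) simp_all
      then have "\<phi> v \<in> L \<longleftrightarrow> a L * v $ 1 + b L * v $ 2 - g L (v $ 3) = 0" using in_L[OF L] by (metis right_minus_eq)
      also have "a L * v $ 1 + b L * v $ 2 - g L (v $ 3) = \<rho> L * dot (vector [1, t L, t L * t L]) (T v)"
        using \<rho>[OF L] g[OF L] by (simp add: dot_3 T_def power2_eq_square algebra_simps)
      finally show ?thesis using \<rho>[OF L] by simp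
    qed
    then show ?thesis by (intro bexI[of _ "vector [1, t L, t L * t L]"]) (auto simp: conic_vecs_def)
  qed
  note in_\<K> = this
  have "\<exists>c\<in>conic_vecs. L = \<phi>' ` {z. dot c z = 0}" if "L \<in> \<K>" for L
  proof -
    obtain c where c: "c \<in> conic_vecs" "\<forall>v. \<phi> v \<in> L \<longleftrightarrow> dot c (T v) = 0"
      using in_\<K>[OF \<open>L \<in> \<K>\<close>] by blast
    have "L = \<phi>' ` {z. dot c z = 0}"
    proof (intro equalityI subsetI)
      fix y assume "y \<in> L"
      moreover obtain v where "y = \<phi> v" using \<phi>_surj by blast
      ultimately show "y \<in> \<phi>' ` {z. dot c z = 0}"
        using c(2) T_inv by (intro image_eqI[of _ _ "T v"]) (auto simp: \<phi>'_def)
    qed (use c(2) T_inv in \<open>auto simp: \<phi>'_def\<close>)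
    then show ?thesis using c(1) by blast
  qed
  then show ?thesis by (rule dual_pseudo_conic_of_conic_vecs[OF emb odd_k \<phi>'])
qed

end
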